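(* Let $\mathscr M$ be a symmetric monoidal model category which is cofibrantly generated and such that all objects are cofibrant, and let $X$ be a nonempty set. Then the identity functor $\mathrm{Id}:\mathscr M_{\mathbb S}(X)_{\mathrm{proj}}\rightleftarrows\mathscr M_{\mathbb S}(X)_{\mathrm{inj}}:\mathrm{Id}$ is a Quillen equivalence.
   Context: For a nonempty set $X$ and $A,B\in X$, let $\mathbb S_{\overline X}(A,B)$ be the category whose objects are finite sequences $t=(E_0,\dots,E_n)$ of elements of $X$ with $n\ge1$, $E_0=A$, $E_n=B$, and whose morphisms $(E_0,\dots,E_n)\to(E'_0,\dots,E'_m)$ are surjective nondecreasing maps $f:\{0,\dots,n-1\}\to\{0,\dots,m-1\}$ with $E'_j=E_{\min f^{-1}(j)}$ for $0\le j<m$. Concatenation of sequences and ordinal sum of maps give strictly associative functors $\otimes:\mathbb S_{\overline X}(A,B)\times\mathbb S_{\overline X}(B,C)\to\mathbb S_{\overline X}(A,C)$. $\mathscr M_{\mathbb S}(X)$ is the category of lax functors $F:(\mathbb S_{\overline X})^{2\text{-op}}\to\mathscr M$: functors $F_{AB}:\mathbb S_{\overline X}(A,B)^{op}\to\mathscr M$ with natural laxity maps $\varphi_{s,t}:F(s)\otimes F(t)\to F(s\otimes t)$ satisfying associativity (no unit data). Morphisms are families of natural transformations $F_{AB}\to G_{AB}$ commuting with the laxity maps. $\mathcal K_X=\prod_{(A,B)\in X^2}\mathrm{Hom}[\mathbb S_{\overline X}(A,B)^{op},\mathscr M]$ and $\mathcal U:\mathscr M_{\mathbb S}(X)\to\mathcal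 K_X$ forgets the laxity maps. $\mathscr M_{\mathbb S}(X)_{\mathrm{proj}}$ (resp. $\mathscr M_{\mathbb S}(X)_{\mathrm{inj}}$) is $\mathscr M_{\mathbb S}(X)$ with the model structure whose weak equivalences and fibrations are the maps $\sigma$ such that $\mathcal U(\sigma)$ is a weak equivalence, resp. fibration, in $\mathcal K_X$ with the product projective (level-wise weak equivalences and fibrations), resp. product injective (level-wise weak equivalences and cofibrations), model structure; cofibrations are the maps with the left lifting property against all trivial fibrations. *)

theory Defs
  imports "HOL-Library.FuncSet"
begin

unbundle cardinal_syntax

section \<open>Size\<close>

text \<open>
  Smallness is relative to a type \<open>'u\<close>, passed as a type token: a set is small if it has fewer
  elements than \<open>'u\<close>. When the cardinality of \<open>'u\<close> is inaccessible these are the small sets of a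
  Grothendieck universe. Every small set is equinumerous with a subset of \<open>'u\<close>, so it loses
  nothing to index small diagrams by categories with objects and arrows in \<open>'u\<close>, and transfinite
  sequences by well-orders on subsets of \<open>'u\<close>.
\<close>

definition small :: "'u itself \<Rightarrow> 'a set \<Rightarrow> bool" where
  "small U S \<longleftrightarrow> |S| <o |UNIV :: 'u set|"


section \<open>Categories\<close>

record ('o, 'm) category =
  Obj :: "'o set"
  Arr :: "'m set"
  Dom :: "'m \<Rightarrow> 'o"
  Cod :: "'m \<Rightarrow> 'o"
  Ide :: "'o \<Rightarrow> 'm"
  Cmp :: "'m \<Rightarrow> 'm \<Rightarrow> 'm"  (infixr "\<cdot>\<index>" 70)

definition Hom :: "('o, 'm, 'z) category_scheme \<Rightarrow> 'o \<Rightarrow> 'o \<Rightarrow> 'm set" where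
  "Hom C A B = {f \<in> Arr C. Dom C f = A \<and> Cod C f = B}"

locale category =
  fixes C :: "('o, 'm, 'z) category_scheme"  (structure)
  assumes Dom_in_Obj: "f \<in> Arr C \<Longrightarrow> Dom C f \<in> Obj C"
    and Cod_in_Obj: "f \<in> Arr C \<Longrightarrow> Cod C f \<in> Obj C"
    and Ide_in_Hom: "A \<in> Obj C \<Longrightarrow> Ide C A \<in> Hom C A A"
    and Cmp_in_Hom: "f \<in> Hom C A B \<Longrightarrow> g \<in> Hom C B D \<Longrightarrow> g \<cdot> f \<in> Hom C A D"
    and Cmp_Ide: "f \<in> Hom C A B \<Longrightarrow> f \<cdot> Ide C A = f"
    and Ide_Cmp: "f \<in> Hom C A B \<Longrightarrow> Ide C B \<cdot> f = f"
    and Cmp_assoc: "f \<in> Hom C A B \<Longrightarrow> g \<in> Hom C B D \<Longrightarrow> h \<in> Hom C D E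
      \<Longrightarrow> (h \<cdot> g) \<cdot> f = h \<cdot> (g \<cdot> f)"

definition op_cat :: "('o, 'm, 'z) category_scheme \<Rightarrow> ('o, 'm) category" where
  "op_cat C = \<lparr>Obj = Obj C, Arr = Arr C, Dom = Cod C, Cod = Dom C, Ide = Ide C,
     Cmp = (\<lambda>g f. f \<cdot>\<^bsub>C\<^esub> g)\<rparr>"

definition is_iso :: "('o, 'm, 'z) category_scheme \<Rightarrow> 'm \<Rightarrow> bool" where
  "is_iso C f \<longleftrightarrow> f \<in> Arr C \<and> (\<exists>g \<in> Hom C (Cod C f) (Dom C f).
     g \<cdot>\<^bsub>C\<^esub> f = Ide C (Dom C f) \<and> f \<cdot>\<^bsub>C\<^esub> g = Ide C (Cod C f))"

definition is_initial :: "('o, 'm, 'z) category_scheme \<Rightarrow> 'o \<Rightarrow> bool" where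
  "is_initial C Z \<longleftrightarrow> Z \<in> Obj C \<and> (\<forall>A \<in> Obj C. \<exists>!f. f \<in> Hom C Z A)"

definition is_terminal :: "('o, 'm, 'z) category_scheme \<Rightarrow> 'o \<Rightarrow> bool" where
  "is_terminal C Z \<longleftrightarrow> Z \<in> Obj C \<and> (\<forall>A \<in> Obj C. \<exists>!f. f \<in> Hom C A Z)"


section \<open>Functors\<close>

record ('o, 'm, 'p, 'n) functr =
  FO :: "'o \<Rightarrow> 'p"
  FM :: "'m \<Rightarrow> 'n"

locale cfunctor =
  source: category C + target: category D
  for C :: "('o, 'm, 'z) category_scheme"
    and D :: "('p, 'n, 'y) category_scheme"
    and T :: "('o, 'm, 'p, 'n) functr" +
  assumes FO_in_Obj: "A \<in> Obj C \<Longrightarrow> FO T A \<in> Obj D"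
    and FM_in_Hom: "f \<in> Hom C A B \<Longrightarrow> FM T f \<in> Hom D (FO T A) (FO T B)"
    and FM_Ide: "A \<in> Obj C \<Longrightarrow> FM T (Ide C A) = Ide D (FO T A)"
    and FM_Cmp: "f \<in> Hom C A B \<Longrightarrow> g \<in> Hom C B E
      \<Longrightarrow> FM T (g \<cdot>\<^bsub>C\<^esub> f) = FM T g \<cdot>\<^bsub>D\<^esub> FM T f"

definition id_functor :: "('o, 'm, 'o, 'm) functr" where
  "id_functor = \<lparr>FO = (\<lambda>A. A), FM = (\<lambda>f. f)\<rparr>"

locale adjunction =
  left: cfunctor C D L + right: cfunctor D C R
  for C :: "('o, 'm, 'z) category_scheme"
    and D :: "('p, 'n, 'y) category_scheme"
    and L :: "('o, 'm, 'p, 'n) functr"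
    and R :: "('p, 'n, 'o, 'm) functr"
    and \<phi> :: "'o \<Rightarrow> 'p \<Rightarrow> 'n \<Rightarrow> 'm" +
  assumes adj_bij: "A \<in> Obj C \<Longrightarrow> B \<in> Obj D
      \<Longrightarrow> bij_betw (\<phi> A B) (Hom D (FO L A) B) (Hom C A (FO R B))"
    and adj_natural_source: "f \<in> Hom D (FO L A) B \<Longrightarrow> h \<in> Hom C A' A \<Longrightarrow> A \<in> Obj C \<Longrightarrow> B \<in> Obj D
      \<Longrightarrow> \<phi> A' B (f \<cdot>\<^bsub>D\<^esub> FM L h) = \<phi> A B f \<cdot>\<^bsub>C\<^esub> h"
    and adj_natural_target: "f \<in> Hom D (FO L A) B \<Longrightarrow> g \<in> Hom D B B' \<Longrightarrow> A \<in> Obj C \<Longrightarrow> B \<in> Obj D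
      \<Longrightarrow> \<phi> A B' (g \<cdot>\<^bsub>D\<^esub> f) = FM R g \<cdot>\<^bsub>C\<^esub> \<phi> A B f"

text \<open>
  Functor categories and product categories. An arrow carries its domain and codomain, and all
  functions are \<open>undefined\<close> off their domains, so that HOL equality is equality of functors and
  of natural transformations.
\<close>

type_synonym ('o, 'm, 'p, 'n) nattr =
  "('o, 'm, 'p, 'n) functr \<times> ('o, 'm, 'p, 'n) functr \<times> ('o \<Rightarrow> 'n)"

definition component :: "('o, 'm, 'p, 'n) nattr \<Rightarrow> 'o \<Rightarrow> 'n" where
  "component \<sigma> = snd (snd \<sigma>)"

definition functor_cat ::
  "('o, 'm, 'z) category_scheme \<Rightarrow> ('p, 'n, 'y) category_scheme
    \<Rightarrow> (('o, 'm, 'p, 'n) functr, ('o, 'm, 'p, 'n) nattr) category" where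
  "functor_cat C D =
    (let objs = {T. cfunctor C D T \<and> FO T \<in> extensional (Obj C) \<and> FM T \<in> extensional (Arr C)} in
     \<lparr>Obj = objs,
      Arr = {(F, G, \<sigma>). F \<in> objs \<and> G \<in> objs \<and> \<sigma> \<in> extensional (Obj C) \<and>
        (\<forall>A \<in> Obj C. \<sigma> A \<in> Hom D (FO F A) (FO G A)) \<and>
        (\<forall>f \<in> Arr C. FM G f \<cdot>\<^bsub>D\<^esub> \<sigma> (Dom C f) = \<sigma> (Cod C f) \<cdot>\<^bsub>D\<^esub> FM F f)},
      Dom = fst,
      Cod = fst \<circ> snd,
      Ide = (\<lambda>F. (F, F, \<lambda>A \<in> Obj C. Ide D (FO F A))),
      Cmp = (\<lambda>\<tau> \<sigma>. (fst \<sigma>, fst (snd \<tau>), \<lambda>A \<in> Obj C. component \<tau> A \<cdot>\<^bsub>D\<^esub> component \<sigma> A))\<rparr>)"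

definition product_cat ::
  "'i set \<Rightarrow> ('i \<Rightarrow> ('o, 'm, 'z) category_scheme) \<Rightarrow> ('i \<Rightarrow> 'o, 'i \<Rightarrow> 'm) category" where
  "product_cat I C =
    \<lparr>Obj = (\<Pi>\<^sub>E i \<in> I. Obj (C i)),
     Arr = (\<Pi>\<^sub>E i \<in> I. Arr (C i)),
     Dom = (\<lambda>f. \<lambda>i \<in> I. Dom (C i) (f i)),
     Cod = (\<lambda>f. \<lambda>i \<in> I. Cod (C i) (f i)),
     Ide = (\<lambda>A. \<lambda>i \<in> I. Ide (C i) (A i)),
     Cmp = (\<lambda>g f. \<lambda>i \<in> I. g i \<cdot>\<^bsub>C i\<^esub> f i)\<rparr>"


section \<open>Limits and colimits\<close>

definition is_cocone ::
  "('o, 'm, 'z) category_scheme \<Rightarrow> ('j, 'k, 'y) category_scheme \<Rightarrow> ('j, 'k, 'o, 'm) functr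
    \<Rightarrow> 'o \<Rightarrow> ('j \<Rightarrow> 'm) \<Rightarrow> bool" where
  "is_cocone C J D Q \<iota> \<longleftrightarrow> Q \<in> Obj C \<and> (\<forall>j \<in> Obj J. \<iota> j \<in> Hom C (FO D j) Q) \<and>
     (\<forall>k \<in> Arr J. \<iota> (Cod J k) \<cdot>\<^bsub>C\<^esub> FM D k = \<iota> (Dom J k))"

definition is_colimit ::
  "('o, 'm, 'z) category_scheme \<Rightarrow> ('j, 'k, 'y) category_scheme \<Rightarrow> ('j, 'k, 'o, 'm) functr
    \<Rightarrow> 'o \<Rightarrow> ('j \<Rightarrow> 'm) \<Rightarrow> bool" where
  "is_colimit C J D Q \<iota> \<longleftrightarrow> is_cocone C J D Q \<iota> \<and>
     (\<forall>A \<alpha>. is_cocone C J D A \<alpha> \<longrightarrow>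
        (\<exists>!h. h \<in> Hom C Q A \<and> (\<forall>j \<in> Obj J. h \<cdot>\<^bsub>C\<^esub> \<iota> j = \<alpha> j)))"

definition is_cone ::
  "('o, 'm, 'z) category_scheme \<Rightarrow> ('j, 'k, 'y) category_scheme \<Rightarrow> ('j, 'k, 'o, 'm) functr
    \<Rightarrow> 'o \<Rightarrow> ('j \<Rightarrow> 'm) \<Rightarrow> bool" where
  "is_cone C J D P \<pi> \<longleftrightarrow> P \<in> Obj C \<and> (\<forall>j \<in> Obj J. \<pi> j \<in> Hom C P (FO D j)) \<and>
     (\<forall>k \<in> Arr J. FM D k \<cdot>\<^bsub>C\<^esub> \<pi> (Dom J k) = \<pi> (Cod J k))"

definition is_limit ::
  "('o, 'm, 'z) category_scheme \<Rightarrow> ('j, 'k, 'y) category_scheme \<Rightarrow> ('j, 'k, 'o, 'm) functr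
    \<Rightarrow> 'o \<Rightarrow> ('j \<Rightarrow> 'm) \<Rightarrow> bool" where
  "is_limit C J D P \<pi> \<longleftrightarrow> is_cone C J D P \<pi> \<and>
     (\<forall>A \<alpha>. is_cone C J D A \<alpha> \<longrightarrow>
        (\<exists>!h. h \<in> Hom C A P \<and> (\<forall>j \<in> Obj J. \<pi> j \<cdot>\<^bsub>C\<^esub> h = \<alpha> j)))"

definition complete :: "'u itself \<Rightarrow> ('o, 'm, 'z) category_scheme \<Rightarrow> bool" where
  "complete U C \<longleftrightarrow> (\<forall>(J :: ('u, 'u) category) D.
     small U (Obj J) \<and> small U (Arr J) \<and> cfunctor J C D \<longrightarrow> (\<exists>P \<pi>. is_limit C J D P \<pi>))"

definition cocomplete :: "'u itself \<Rightarrow> ('o, 'm, 'z) category_scheme \<Rightarrow> bool" where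
  "cocomplete U C \<longleftrightarrow> (\<forall>(J :: ('u, 'u) category) D.
     small U (Obj J) \<and> small U (Arr J) \<and> cfunctor J C D \<longrightarrow> (\<exists>Q \<iota>. is_colimit C J D Q \<iota>))"

text \<open>\<open>P\<close>, the common codomain of \<open>p\<close> and \<open>q\<close>, is the pushout of \<open>f : A \<rightarrow> B\<close> and \<open>g : A \<rightarrow> C\<close>
  via \<open>p : B \<rightarrow> P\<close> and \<open>q : C \<rightarrow> P\<close>.\<close>

definition is_pushout ::
  "('o, 'm, 'z) category_scheme \<Rightarrow> 'm \<Rightarrow> 'm \<Rightarrow> 'm \<Rightarrow> 'm \<Rightarrow> bool" where
  "is_pushout C f g p q \<longleftrightarrow>
     f \<in> Arr C \<and> g \<in> Arr C \<and> p \<in> Arr C \<and> q \<in> Arr C \<and> Dom C f = Dom C g \<and>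
     Dom C p = Cod C f \<and> Dom C q = Cod C g \<and> Cod C p = Cod C q \<and> p \<cdot>\<^bsub>C\<^esub> f = q \<cdot>\<^bsub>C\<^esub> g \<and>
     (\<forall>A. \<forall>a \<in> Hom C (Cod C f) A. \<forall>b \<in> Hom C (Cod C g) A. a \<cdot>\<^bsub>C\<^esub> f = b \<cdot>\<^bsub>C\<^esub> g \<longrightarrow>
        (\<exists>!h. h \<in> Hom C (Cod C p) A \<and> h \<cdot>\<^bsub>C\<^esub> p = a \<and> h \<cdot>\<^bsub>C\<^esub> q = b))"


section \<open>Model categories\<close>

record 'm model_structure =
  weq :: "'m set"
  cof :: "'m set"
  fib :: "'m set"

definition has_lift :: "('o, 'm, 'z) category_scheme \<Rightarrow> 'm \<Rightarrow> 'm \<Rightarrow> bool" where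
  "has_lift C i p \<longleftrightarrow>
     (\<forall>u \<in> Hom C (Dom C i) (Dom C p). \<forall>v \<in> Hom C (Cod C i) (Cod C p). p \<cdot>\<^bsub>C\<^esub> u = v \<cdot>\<^bsub>C\<^esub> i \<longrightarrow>
        (\<exists>h \<in> Hom C (Cod C i) (Dom C p). h \<cdot>\<^bsub>C\<^esub> i = u \<and> p \<cdot>\<^bsub>C\<^esub> h = v))"

definition llp :: "('o, 'm, 'z) category_scheme \<Rightarrow> 'm set \<Rightarrow> 'm set" where
  "llp C K = {i \<in> Arr C. \<forall>p \<in> K. has_lift C i p}"

definition rlp :: "('o, 'm, 'z) category_scheme \<Rightarrow> 'm set \<Rightarrow> 'm set" where
  "rlp C K = {p \<in> Arr C. \<forall>i \<in> K. has_lift C i p}"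

definition wide_subcategory :: "('o, 'm, 'z) category_scheme \<Rightarrow> 'm set \<Rightarrow> bool" where
  "wide_subcategory C K \<longleftrightarrow> K \<subseteq> Arr C \<and> (\<forall>A \<in> Obj C. Ide C A \<in> K) \<and>
     (\<forall>f \<in> K. \<forall>g \<in> K. Cod C f = Dom C g \<longrightarrow> g \<cdot>\<^bsub>C\<^esub> f \<in> K)"

definition is_retract :: "('o, 'm, 'z) category_scheme \<Rightarrow> 'm \<Rightarrow> 'm \<Rightarrow> bool" where
  "is_retract C f g \<longleftrightarrow> f \<in> Arr C \<and> g \<in> Arr C \<and>
     (\<exists>i \<in> Hom C (Dom C f) (Dom C g). \<exists>r \<in> Hom C (Dom C g) (Dom C f).
      \<exists>j \<in> Hom C (Cod C f) (Cod C g). \<exists>s \<in> Hom C (Cod C g) (Cod C f).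
        r \<cdot>\<^bsub>C\<^esub> i = Ide C (Dom C f) \<and> s \<cdot>\<^bsub>C\<^esub> j = Ide C (Cod C f) \<and>
        g \<cdot>\<^bsub>C\<^esub> i = j \<cdot>\<^bsub>C\<^esub> f \<and> f \<cdot>\<^bsub>C\<^esub> r = s \<cdot>\<^bsub>C\<^esub> g)"

definition retract_closed :: "('o, 'm, 'z) category_scheme \<Rightarrow> 'm set \<Rightarrow> bool" where
  "retract_closed C K \<longleftrightarrow> (\<forall>f. \<forall>g \<in> K. is_retract C f g \<longrightarrow> f \<in> K)"

locale model_category = category C
  for U :: "'u itself"
    and C :: "('o, 'm, 'z) category_scheme"  (structure)
    and S :: "'m model_structure" +
  assumes complete: "complete U C"
    and cocomplete: "cocomplete U C"
    and subcategories: "wide_subcategory C (weq S)" "wide_subcategory C (cof S)"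
      "wide_subcategory C (fib S)"
    and two_out_of_three_left:
      "f \<in> Hom C A B \<Longrightarrow> g \<in> Hom C B D \<Longrightarrow> g \<in> weq S \<Longrightarrow> g \<cdot> f \<in> weq S \<Longrightarrow> f \<in> weq S"
    and two_out_of_three_right:
      "f \<in> Hom C A B \<Longrightarrow> g \<in> Hom C B D \<Longrightarrow> f \<in> weq S \<Longrightarrow> g \<cdot> f \<in> weq S \<Longrightarrow> g \<in> weq S"
    and retracts: "retract_closed C (weq S)" "retract_closed C (cof S)" "retract_closed C (fib S)"
    and lifting_cof: "i \<in> cof S \<Longrightarrow> p \<in> weq S \<inter> fib S \<Longrightarrow> has_lift C i p"
    and lifting_fib: "i \<in> weq S \<inter> cof S \<Longrightarrow> p \<in> fib S \<Longrightarrow> has_lift C i p"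
    and factorization_cof: "f \<in> Hom C A B
      \<Longrightarrow> \<exists>E. \<exists>i \<in> Hom C A E. \<exists>p \<in> Hom C E B. f = p \<cdot> i \<and> i \<in> cof S \<and> p \<in> weq S \<inter> fib S"
    and factorization_fib: "f \<in> Hom C A B
      \<Longrightarrow> \<exists>E. \<exists>i \<in> Hom C A E. \<exists>p \<in> Hom C E B. f = p \<cdot> i \<and> i \<in> weq S \<inter> cof S \<and> p \<in> fib S"

definition cofibrant :: "('o, 'm, 'z) category_scheme \<Rightarrow> 'm model_structure \<Rightarrow> 'o \<Rightarrow> bool" where
  "cofibrant C S A \<longleftrightarrow> A \<in> Obj C \<and> (\<exists>Z. is_initial C Z \<and> (\<exists>f \<in> Hom C Z A. f \<in> cof S))"

definition fibrant :: "('o, 'm, 'z) category_scheme \<Rightarrow> 'm model_structure \<Rightarrow> 'o \<Rightarrow> bool" where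
  "fibrant C S A \<longleftrightarrow> A \<in> Obj C \<and> (\<exists>Z. is_terminal C Z \<and> (\<exists>f \<in> Hom C A Z. f \<in> fib S))"

locale quillen_adjunction =
  source: model_category U C S + target: model_category U D T + adjunction C D L R \<phi>
  for U :: "'u itself"
    and C :: "('o, 'm, 'z) category_scheme" and S :: "'m model_structure"
    and D :: "('p, 'n, 'y) category_scheme" and T :: "'n model_structure"
    and L :: "('o, 'm, 'p, 'n) functr" and R :: "('p, 'n, 'o, 'm) functr"
    and \<phi> :: "'o \<Rightarrow> 'p \<Rightarrow> 'n \<Rightarrow> 'm" +
  assumes left_preserves_cof: "f \<in> cof S \<Longrightarrow> FM L f \<in> cof T"
    and left_preserves_trivial_cof: "f \<in> weq S \<inter> cof S \<Longrightarrow> FM L f \<in> weq T \<inter> cof T"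

locale quillen_equivalence = quillen_adjunction U C S D T L R \<phi>
  for U :: "'u itself"
    and C :: "('o, 'm, 'z) category_scheme" and S :: "'m model_structure"
    and D :: "('p, 'n, 'y) category_scheme" and T :: "'n model_structure"
    and L :: "('o, 'm, 'p, 'n) functr" and R :: "('p, 'n, 'o, 'm) functr"
    and \<phi> :: "'o \<Rightarrow> 'p \<Rightarrow> 'n \<Rightarrow> 'm" +
  assumes adjunct_weq_iff: "cofibrant C S A \<Longrightarrow> fibrant D T B \<Longrightarrow> f \<in> Hom D (FO L A) B
    \<Longrightarrow> f \<in> weq T \<longleftrightarrow> \<phi> A B f \<in> weq S"


section \<open>Cofibrant generation\<close>

text \<open>Ordinals are well-orders \<open>r\<close> in the sense of the cardinals library: reflexive relations
  whose underlying set is \<open>Field r\<close>.\<close>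

definition order_cat :: "'a rel \<Rightarrow> ('a, 'a \<times> 'a) category" where
  "order_cat r = \<lparr>Obj = Field r, Arr = r, Dom = fst, Cod = snd, Ide = (\<lambda>a. (a, a)),
     Cmp = (\<lambda>g f. (fst f, snd g))\<rparr>"

definition is_least :: "'a rel \<Rightarrow> 'a \<Rightarrow> bool" where
  "is_least r a \<longleftrightarrow> a \<in> Field r \<and> (\<forall>b \<in> Field r. (a, b) \<in> r)"

definition is_succ :: "'a rel \<Rightarrow> 'a \<Rightarrow> 'a \<Rightarrow> bool" where
  "is_succ r a b \<longleftrightarrow> (a, b) \<in> r \<and> a \<noteq> b \<and> (\<forall>c. (a, c) \<in> r \<and> c \<noteq> a \<longrightarrow> (b, c) \<in> r)"

definition is_limit_stage :: "'a rel \<Rightarrow> 'a \<Rightarrow> bool" where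
  "is_limit_stage r b \<longleftrightarrow> b \<in> Field r \<and> \<not> is_least r b \<and> (\<nexists>a. is_succ r a b)"

definition transfinite_sequence ::
  "'u itself \<Rightarrow> ('o, 'm, 'z) category_scheme \<Rightarrow> 'u rel \<Rightarrow> ('u, 'u \<times> 'u, 'o, 'm) functr \<Rightarrow> bool" where
  "transfinite_sequence U C r D \<longleftrightarrow>
     Well_order r \<and> Field r \<noteq> {} \<and> small U (Field r) \<and> cfunctor (order_cat r) C D \<and>
     (\<forall>b. is_limit_stage r b \<longrightarrow>
        is_colimit C (order_cat (Restr r (underS r b))) D (FO D b) (\<lambda>a. FM D (a, b)))"

definition sequence_in :: "'u rel \<Rightarrow> ('u, 'u \<times> 'u, 'o, 'm) functr \<Rightarrow> 'm set \<Rightarrow> bool" where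
  "sequence_in r D K \<longleftrightarrow> (\<forall>a b. is_succ r a b \<longrightarrow> FM D (a, b) \<in> K)"

definition pushouts_of :: "('o, 'm, 'z) category_scheme \<Rightarrow> 'm set \<Rightarrow> 'm set" where
  "pushouts_of C K = {q. \<exists>f \<in> K. \<exists>g p. is_pushout C f g p q}"

definition cell :: "'u itself \<Rightarrow> ('o, 'm, 'z) category_scheme \<Rightarrow> 'm set \<Rightarrow> 'm set" where
  "cell U C K = {f. \<exists>(r :: 'u rel) D Q \<iota> a.
     transfinite_sequence U C r D \<and> sequence_in r D (pushouts_of C K) \<and>
     is_colimit C (order_cat r) D Q \<iota> \<and> is_least r a \<and> f = \<iota> a}"

text \<open>For a cardinal \<open>\<kappa> = |K|\<close>: a limit ordinal in which every subset of cardinality at most \<open>\<kappa>\<close>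
  has its supremum strictly inside.\<close>

definition filtered_ordinal :: "'u set \<Rightarrow> 'u rel \<Rightarrow> bool" where
  "filtered_ordinal K r \<longleftrightarrow> Well_order r \<and> Field r \<noteq> {} \<and>
     (\<forall>a \<in> Field r. \<exists>b. is_succ r a b) \<and>
     (\<forall>A \<subseteq> Field r. |A| \<le>o |K| \<longrightarrow> (\<exists>b \<in> Field r. \<forall>a \<in> A. (a, b) \<in> r))"

text \<open>The two last clauses say that the canonical map
  \<open>colim Hom(A, X\<^sub>b) \<rightarrow> Hom(A, colim X\<^sub>b)\<close> is surjective and injective; elements of the
  directed colimit of sets on the left are arrows \<open>A \<rightarrow> X\<^sub>b\<close>, identified when they agree at
  a later stage.\<close>

definition small_relative ::
  "'u itself \<Rightarrow> ('o, 'm, 'z) category_scheme \<Rightarrow> 'm set \<Rightarrow> 'o \<Rightarrow> bool" where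
  "small_relative U C E A \<longleftrightarrow> A \<in> Obj C \<and>
     (\<exists>K :: 'u set. small U K \<and>
       (\<forall>(r :: 'u rel) D Q \<iota>.
          filtered_ordinal K r \<and> transfinite_sequence U C r D \<and> sequence_in r D E \<and>
          is_colimit C (order_cat r) D Q \<iota> \<longrightarrow>
            (\<forall>f \<in> Hom C A Q. \<exists>b \<in> Field r. \<exists>g \<in> Hom C A (FO D b). f = \<iota> b \<cdot>\<^bsub>C\<^esub> g) \<and>
            (\<forall>b \<in> Field r. \<forall>c \<in> Field r. \<forall>g \<in> Hom C A (FO D b). \<forall>h \<in> Hom C A (FO D c).
               \<iota> b \<cdot>\<^bsub>C\<^esub> g = \<iota> c \<cdot>\<^bsub>C\<^esub> h \<longrightarrow>
                 (\<exists>d. (b, d) \<in> r \<and> (c, d) \<in> r \<and>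
                   FM D (b, d) \<cdot>\<^bsub>C\<^esub> g = FM D (c, d) \<cdot>\<^bsub>C\<^esub> h))))"

definition cofibrantly_generated ::
  "'u itself \<Rightarrow> ('o, 'm, 'z) category_scheme \<Rightarrow> 'm model_structure \<Rightarrow> bool" where
  "cofibrantly_generated U C S \<longleftrightarrow> (\<exists>I J.
     I \<subseteq> Arr C \<and> J \<subseteq> Arr C \<and> small U I \<and> small U J \<and>
     (\<forall>i \<in> I. small_relative U C (cell U C I) (Dom C i)) \<and>
     (\<forall>j \<in> J. small_relative U C (cell U C J) (Dom C j)) \<and>
     fib S = rlp C J \<and> weq S \<inter> fib S = rlp C I)"


section \<open>Symmetric monoidal model categories\<close>

record ('o, 'm) sm_category = "('o, 'm) category" +
  tenO :: "'o \<Rightarrow> 'o \<Rightarrow> 'o"  (infixr "\<otimes>\<index>" 75)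
  tenM :: "'m \<Rightarrow> 'm \<Rightarrow> 'm"  (infixr "\<odot>\<index>" 75)
  unt :: "'o"
  asc :: "'o \<Rightarrow> 'o \<Rightarrow> 'o \<Rightarrow> 'm"
  lunit :: "'o \<Rightarrow> 'm"
  runit :: "'o \<Rightarrow> 'm"
  braid :: "'o \<Rightarrow> 'o \<Rightarrow> 'm"

locale symmetric_monoidal_category = category M
  for M :: "('o, 'm, 'z) sm_category_scheme"  (structure) +
  assumes tenO_in_Obj: "A \<in> Obj M \<Longrightarrow> B \<in> Obj M \<Longrightarrow> A \<otimes> B \<in> Obj M"
    and tenM_in_Hom: "f \<in> Hom M A A' \<Longrightarrow> g \<in> Hom M B B' \<Longrightarrow> f \<odot> g \<in> Hom M (A \<otimes> B) (A' \<otimes> B')"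
    and tenM_Ide: "A \<in> Obj M \<Longrightarrow> B \<in> Obj M \<Longrightarrow> Ide M A \<odot> Ide M B = Ide M (A \<otimes> B)"
    and tenM_Cmp: "f \<in> Hom M A A' \<Longrightarrow> f' \<in> Hom M A' A'' \<Longrightarrow> g \<in> Hom M B B' \<Longrightarrow> g' \<in> Hom M B' B''
      \<Longrightarrow> (f' \<cdot> f) \<odot> (g' \<cdot> g) = (f' \<odot> g') \<cdot> (f \<odot> g)"
    and unt_in_Obj: "unt M \<in> Obj M"
    and asc_in_Hom: "A \<in> Obj M \<Longrightarrow> B \<in> Obj M \<Longrightarrow> D \<in> Obj M
      \<Longrightarrow> asc M A B D \<in> Hom M ((A \<otimes> B) \<otimes> D) (A \<otimes> (B \<otimes> D))"
    and asc_iso: "A \<in> Obj M \<Longrightarrow> B \<in> Obj M \<Longrightarrow> D \<in> Obj M \<Longrightarrow> is_iso M (asc M A B D)"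
    and asc_natural: "f \<in> Hom M A A' \<Longrightarrow> g \<in> Hom M B B' \<Longrightarrow> h \<in> Hom M D D'
      \<Longrightarrow> asc M A' B' D' \<cdot> ((f \<odot> g) \<odot> h) = (f \<odot> (g \<odot> h)) \<cdot> asc M A B D"
    and lunit_in_Hom: "A \<in> Obj M \<Longrightarrow> lunit M A \<in> Hom M (unt M \<otimes> A) A"
    and lunit_iso: "A \<in> Obj M \<Longrightarrow> is_iso M (lunit M A)"
    and lunit_natural: "f \<in> Hom M A A'
      \<Longrightarrow> lunit M A' \<cdot> (Ide M (unt M) \<odot> f) = f \<cdot> lunit M A"
    and runit_in_Hom: "A \<in> Obj M \<Longrightarrow> runit M A \<in> Hom M (A \<otimes> unt M) A"
    and runit_iso: "A \<in> Obj M \<Longrightarrow> is_iso M (runit M A)"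
    and runit_natural: "f \<in> Hom M A A'
      \<Longrightarrow> runit M A' \<cdot> (f \<odot> Ide M (unt M)) = f \<cdot> runit M A"
    and braid_in_Hom: "A \<in> Obj M \<Longrightarrow> B \<in> Obj M \<Longrightarrow> braid M A B \<in> Hom M (A \<otimes> B) (B \<otimes> A)"
    and braid_natural: "f \<in> Hom M A A' \<Longrightarrow> g \<in> Hom M B B'
      \<Longrightarrow> braid M A' B' \<cdot> (f \<odot> g) = (g \<odot> f) \<cdot> braid M A B"
    and braid_braid: "A \<in> Obj M \<Longrightarrow> B \<in> Obj M \<Longrightarrow> braid M B A \<cdot> braid M A B = Ide M (A \<otimes> B)"
    and pentagon: "A \<in> Obj M \<Longrightarrow> B \<in> Obj M \<Longrightarrow> D \<in> Obj M \<Longrightarrow> E \<in> Obj M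
      \<Longrightarrow> asc M A B (D \<otimes> E) \<cdot> asc M (A \<otimes> B) D E =
          (Ide M A \<odot> asc M B D E) \<cdot> asc M A (B \<otimes> D) E \<cdot> (asc M A B D \<odot> Ide M E)"
    and triangle: "A \<in> Obj M \<Longrightarrow> B \<in> Obj M
      \<Longrightarrow> (Ide M A \<odot> lunit M B) \<cdot> asc M A (unt M) B = runit M A \<odot> Ide M B"
    and hexagon: "A \<in> Obj M \<Longrightarrow> B \<in> Obj M \<Longrightarrow> D \<in> Obj M
      \<Longrightarrow> asc M B D A \<cdot> braid M A (B \<otimes> D) \<cdot> asc M A B D =
          (Ide M B \<odot> braid M A D) \<cdot> asc M B A D \<cdot> (braid M A B \<odot> Ide M D)"
    and lunit_braid: "A \<in> Obj M \<Longrightarrow> lunit M A \<cdot> braid M A (unt M) = runit M A"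

text \<open>The functor \<open>- \<otimes> B\<close>.\<close>

definition tensor_right ::
  "('o, 'm, 'z) sm_category_scheme \<Rightarrow> 'o \<Rightarrow> ('o, 'm, 'o, 'm) functr" where
  "tensor_right M B = \<lparr>FO = (\<lambda>A. A \<otimes>\<^bsub>M\<^esub> B), FM = (\<lambda>f. f \<odot>\<^bsub>M\<^esub> Ide M B)\<rparr>"

text \<open>
  Monoidal model categories as in Hovey's book, in particular closed. In \<open>pushout_product\<close>, for
  \<open>f : V \<rightarrow> W\<close> and \<open>g : Y \<rightarrow> Z\<close>, the arrow \<open>k\<close> is the pushout product
  \<open>(V \<otimes> Z) \<squnion> (W \<otimes> Y) \<rightarrow> W \<otimes> Z\<close>, the coproduct being taken over \<open>V \<otimes> Y\<close>.
  In \<open>unit_axiom\<close>, \<open>q\<close> is a cofibrant replacement of the unit.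
\<close>

locale symmetric_monoidal_model_category =
  model_category U M S + symmetric_monoidal_category M
  for U :: "'u itself"
    and M :: "('o, 'm, 'z) sm_category_scheme"  (structure)
    and S :: "'m model_structure" +
  assumes closed: "B \<in> Obj M \<Longrightarrow> \<exists>R \<phi>. adjunction M M (tensor_right M B) R \<phi>"
    and pushout_product:
      "f \<in> cof S \<Longrightarrow> f \<in> Hom M V W \<Longrightarrow> g \<in> cof S \<Longrightarrow> g \<in> Hom M Y Z
       \<Longrightarrow> is_pushout M (Ide M V \<odot> g) (f \<odot> Ide M Y) p q
       \<Longrightarrow> k \<in> Hom M (Cod M p) (W \<otimes> Z)
       \<Longrightarrow> k \<cdot> p = f \<odot> Ide M Z \<Longrightarrow> k \<cdot> q = Ide M W \<odot> g
       \<Longrightarrow> k \<in> cof S \<and> (f \<in> weq S \<or> g \<in> weq S \<longrightarrow> k \<in> weq S)"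
    and unit_axiom:
      "cofibrant M S Q \<Longrightarrow> q \<in> Hom M Q (unt M) \<Longrightarrow> q \<in> weq S \<inter> fib S \<Longrightarrow> cofibrant M S A
       \<Longrightarrow> q \<odot> Ide M A \<in> weq S"


section \<open>The categories of sequences\<close>

text \<open>The sequence \<open>(E\<^sub>0, \<dots>, E\<^sub>n)\<close> is a list of length \<open>n + 1\<close>, and \<open>n\<close> is its \<open>degree\<close>. An arrow
  \<open>(s, t, f)\<close> consists of its domain, its codomain, and a map \<open>f\<close> which is \<open>undefined\<close>
  off \<open>{0, \<dots>, degree s - 1}\<close>.\<close>

type_synonym 'x seq_arr = "'x list \<times> 'x list \<times> (nat \<Rightarrow> nat)"

definition degree :: "'x list \<Rightarrow> nat" where
  "degree t = length t - 1"

definition seq_objs :: "'x set \<Rightarrow> 'x \<Rightarrow> 'x \<Rightarrow> 'x list set" where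
  "seq_objs X A B = {t. set t \<subseteq> X \<and> length t \<ge> 2 \<and> hd t = A \<and> last t = B}"

definition seq_cat :: "'x set \<Rightarrow> 'x \<Rightarrow> 'x \<Rightarrow> ('x list, 'x seq_arr) category" where
  "seq_cat X A B =
    \<lparr>Obj = seq_objs X A B,
     Arr = {(s, t, f). s \<in> seq_objs X A B \<and> t \<in> seq_objs X A B \<and>
       f \<in> {..<degree s} \<rightarrow>\<^sub>E {..<degree t} \<and> f ` {..<degree s} = {..<degree t} \<and>
       mono_on {..<degree s} f \<and>
       (\<forall>j < degree t. t ! j = s ! Min {i. i < degree s \<and> f i = j})},
     Dom = fst,
     Cod = fst \<circ> snd,
     Ide = (\<lambda>t. (t, t, \<lambda>i \<in> {..<degree t}. i)),
     Cmp = (\<lambda>(s', t', g) (s, t, f). (s, t', \<lambda>i \<in> {..<degree s}. g (f i)))\<rparr>"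

text \<open>Concatenation identifies the last entry of \<open>s\<close> with the first entry of \<open>t\<close>.\<close>

definition concO :: "'x list \<Rightarrow> 'x list \<Rightarrow> 'x list" where
  "concO s t = s @ tl t"

definition concM :: "'x seq_arr \<Rightarrow> 'x seq_arr \<Rightarrow> 'x seq_arr" where
  "concM = (\<lambda>(s, s', f) (t, t', g). (concO s t, concO s' t',
     \<lambda>i \<in> {..<degree s + degree t}.
       if i < degree s then f i else degree s' + g (i - degree s)))"


section \<open>Lax functors\<close>

type_synonym ('x, 'o, 'm) seq_functr = "('x list, 'x seq_arr, 'o, 'm) functr"
type_synonym ('x, 'o, 'm) seq_nattr = "('x list, 'x seq_arr, 'o, 'm) nattr"
type_synonym ('x, 'o, 'm) K_obj = "'x \<times> 'x \<Rightarrow> ('x, 'o, 'm) seq_functr"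
type_synonym ('x, 'o, 'm) K_arr = "'x \<times> 'x \<Rightarrow> ('x, 'o, 'm) seq_nattr"

definition K_cat ::
  "('o, 'm, 'z) category_scheme \<Rightarrow> 'x set
    \<Rightarrow> (('x, 'o, 'm) K_obj, ('x, 'o, 'm) K_arr) category" where
  "K_cat M X = product_cat (X \<times> X) (\<lambda>(A, B). functor_cat (op_cat (seq_cat X A B)) M)"

text \<open>The laxity map \<open>\<phi> s t\<close> does not mention \<open>A\<close>, \<open>B\<close>, \<open>C\<close>, which are determined by the end
  points of \<open>s\<close> and \<open>t\<close>.\<close>

type_synonym ('x, 'm) laxity = "'x list \<Rightarrow> 'x list \<Rightarrow> 'm"

definition is_laxity ::
  "('o, 'm, 'z) sm_category_scheme \<Rightarrow> 'x set \<Rightarrow> ('x, 'o, 'm) K_obj \<Rightarrow> ('x, 'm) laxity \<Rightarrow> bool" where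
  "is_laxity M X F \<phi> \<longleftrightarrow>
    (\<forall>s t. \<not> (\<exists>A \<in> X. \<exists>B \<in> X. \<exists>C \<in> X. s \<in> seq_objs X A B \<and> t \<in> seq_objs X B C)
       \<longrightarrow> \<phi> s t = undefined) \<and>
    (\<forall>A \<in> X. \<forall>B \<in> X. \<forall>C \<in> X. \<forall>s \<in> seq_objs X A B. \<forall>t \<in> seq_objs X B C.
       \<phi> s t \<in> Hom M (FO (F (A, B)) s \<otimes>\<^bsub>M\<^esub> FO (F (B, C)) t) (FO (F (A, C)) (concO s t))) \<and>
    (\<forall>A \<in> X. \<forall>B \<in> X. \<forall>C \<in> X. \<forall>f \<in> Arr (seq_cat X A B). \<forall>g \<in> Arr (seq_cat X B C).
       FM (F (A, C)) (concM f g) \<cdot>\<^bsub>M\<^esub> \<phi> (Cod (seq_cat X A B) f) (Cod (seq_cat X B C) g) =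
       \<phi> (Dom (seq_cat X A B) f) (Dom (seq_cat X B C) g)
         \<cdot>\<^bsub>M\<^esub> (FM (F (A, B)) f \<odot>\<^bsub>M\<^esub> FM (F (B, C)) g)) \<and>
    (\<forall>A \<in> X. \<forall>B \<in> X. \<forall>C \<in> X. \<forall>D \<in> X.
     \<forall>s \<in> seq_objs X A B. \<forall>t \<in> seq_objs X B C. \<forall>u \<in> seq_objs X C D.
       \<phi> (concO s t) u \<cdot>\<^bsub>M\<^esub> (\<phi> s t \<odot>\<^bsub>M\<^esub> Ide M (FO (F (C, D)) u)) =
       \<phi> s (concO t u) \<cdot>\<^bsub>M\<^esub> (Ide M (FO (F (A, B)) s) \<odot>\<^bsub>M\<^esub> \<phi> t u)
         \<cdot>\<^bsub>M\<^esub> asc M (FO (F (A, B)) s) (FO (F (B, C)) t) (FO (F (C, D)) u))"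

type_synonym ('x, 'o, 'm) lax_obj = "('x, 'o, 'm) K_obj \<times> ('x, 'm) laxity"
type_synonym ('x, 'o, 'm) lax_arr =
  "('x, 'o, 'm) lax_obj \<times> ('x, 'o, 'm) lax_obj \<times> ('x, 'o, 'm) K_arr"

definition commutes_with_laxity ::
  "('o, 'm, 'z) sm_category_scheme \<Rightarrow> 'x set \<Rightarrow> ('x, 'm) laxity \<Rightarrow> ('x, 'm) laxity
    \<Rightarrow> ('x, 'o, 'm) K_arr \<Rightarrow> bool" where
  "commutes_with_laxity M X \<phi> \<psi> \<sigma> \<longleftrightarrow>
    (\<forall>A \<in> X. \<forall>B \<in> X. \<forall>C \<in> X. \<forall>s \<in> seq_objs X A B. \<forall>t \<in> seq_objs X B C.
       component (\<sigma> (A, C)) (concO s t) \<cdot>\<^bsub>M\<^esub> \<phi> s t =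
       \<psi> s t \<cdot>\<^bsub>M\<^esub> (component (\<sigma> (A, B)) s \<odot>\<^bsub>M\<^esub> component (\<sigma> (B, C)) t))"

definition lax_cat ::
  "('o, 'm, 'z) sm_category_scheme \<Rightarrow> 'x set
    \<Rightarrow> (('x, 'o, 'm) lax_obj, ('x, 'o, 'm) lax_arr) category" where
  "lax_cat M X =
    (let objs = {(F, \<phi>). F \<in> Obj (K_cat M X) \<and> is_laxity M X F \<phi>} in
     \<lparr>Obj = objs,
      Arr = {(F, G, \<sigma>). F \<in> objs \<and> G \<in> objs \<and> \<sigma> \<in> Hom (K_cat M X) (fst F) (fst G) \<and>
        commutes_with_laxity M X (snd F) (snd G) \<sigma>},
      Dom = fst,
      Cod = fst \<circ> snd,
      Ide = (\<lambda>F. (F, F, Ide (K_cat M X) (fst F))),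
      Cmp = (\<lambda>(F', G', \<tau>) (F, G, \<sigma>). (F, G', \<tau> \<cdot>\<^bsub>K_cat M X\<^esub> \<sigma>))\<rparr>)"

definition forget_laxity ::
  "(('x, 'o, 'm) lax_obj, ('x, 'o, 'm) lax_arr, ('x, 'o, 'm) K_obj, ('x, 'o, 'm) K_arr) functr" where
  "forget_laxity = \<lparr>FO = fst, FM = snd \<circ> snd\<rparr>"


section \<open>Projective and injective structures\<close>

definition levelwise ::
  "('o, 'm, 'z) category_scheme \<Rightarrow> ('p, 'n, 'y) category_scheme \<Rightarrow> 'n set
    \<Rightarrow> ('o, 'm, 'p, 'n) nattr set" where
  "levelwise C D K = {\<sigma> \<in> Arr (functor_cat C D). \<forall>A \<in> Obj C. component \<sigma> A \<in> K}"

definition projective_structure ::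
  "('o, 'm, 'z) category_scheme \<Rightarrow> ('p, 'n, 'y) category_scheme \<Rightarrow> 'n model_structure
    \<Rightarrow> ('o, 'm, 'p, 'n) nattr model_structure" where
  "projective_structure C D S =
    \<lparr>weq = levelwise C D (weq S),
     cof = llp (functor_cat C D) (levelwise C D (weq S) \<inter> levelwise C D (fib S)),
     fib = levelwise C D (fib S)\<rparr>"

definition injective_structure ::
  "('o, 'm, 'z) category_scheme \<Rightarrow> ('p, 'n, 'y) category_scheme \<Rightarrow> 'n model_structure
    \<Rightarrow> ('o, 'm, 'p, 'n) nattr model_structure" where
  "injective_structure C D S =
    \<lparr>weq = levelwise C D (weq S),
     cof = levelwise C D (cof S),
     fib = rlp (functor_cat C D) (levelwise C D (weq S) \<inter> levelwise C D (cof S))\<rparr>"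

definition product_structure ::
  "'i set \<Rightarrow> ('i \<Rightarrow> 'm model_structure) \<Rightarrow> ('i \<Rightarrow> 'm) model_structure" where
  "product_structure I S =
    \<lparr>weq = (\<Pi>\<^sub>E i \<in> I. weq (S i)), cof = (\<Pi>\<^sub>E i \<in> I. cof (S i)), fib = (\<Pi>\<^sub>E i \<in> I. fib (S i))\<rparr>"

definition K_proj ::
  "('o, 'm, 'z) category_scheme \<Rightarrow> 'm model_structure \<Rightarrow> 'x set
    \<Rightarrow> ('x, 'o, 'm) K_arr model_structure" where
  "K_proj M S X =
    product_structure (X \<times> X) (\<lambda>(A, B). projective_structure (op_cat (seq_cat X A B)) M S)"

definition K_inj ::
  "('o, 'm, 'z) category_scheme \<Rightarrow> 'm model_structure \<Rightarrow> 'x set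
    \<Rightarrow> ('x, 'o, 'm) K_arr model_structure" where
  "K_inj M S X =
    product_structure (X \<times> X) (\<lambda>(A, B). injective_structure (op_cat (seq_cat X A B)) M S)"

text \<open>Weak equivalences and fibrations are created by the functor \<open>V\<close>; cofibrations are determined
  by the lifting property. These are the data of a model structure, whether or not its axioms hold.\<close>

definition transferred_structure ::
  "('o, 'm, 'z) category_scheme \<Rightarrow> ('o, 'm, 'p, 'n) functr \<Rightarrow> 'n model_structure
    \<Rightarrow> 'm model_structure" where
  "transferred_structure C V S =
    (let W = {f \<in> Arr C. FM V f \<in> weq S}; P = {f \<in> Arr C. FM V f \<in> fib S} in
     \<lparr>weq = W, cof = llp C (W \<inter> P), fib = P\<rparr>)"

definition lax_proj ::
  "('o, 'm, 'z) sm_category_scheme \<Rightarrow> 'm model_structure \<Rightarrow> 'x set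
    \<Rightarrow> ('x, 'o, 'm) lax_arr model_structure" where
  "lax_proj M S X = transferred_structure (lax_cat M X) forget_laxity (K_proj M S X)"

definition lax_inj ::
  "('o, 'm, 'z) sm_category_scheme \<Rightarrow> 'm model_structure \<Rightarrow> 'x set
    \<Rightarrow> ('x, 'o, 'm) lax_arr model_structure" where
  "lax_inj M S X = transferred_structure (lax_cat M X) forget_laxity (K_inj M S X)"

end

theory Submission
  imports Defs
begin

text \<open>
  Both structures have the same weak equivalences, so everything reduces to the fact that an
  injective fibration of diagrams is a level-wise fibration. Evaluation at \<open>s\<close> has the left adjoint
  \<open>K \<mapsto> (t \<mapsto> \<Squnion>\<^bsub>Hom(s, t)\<^esub> K)\<close>, which sends trivial cofibrations to level-wise trivial cofibrations
  because these are closed under coproducts. The coproducts needed are finite, the hom sets of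
  the categories of sequences being finite.
\<close>

section \<open>Lifting properties in model categories\<close>

lemma HomD:
  assumes "f \<in> Hom C A B"
  shows "f \<in> Arr C" "Dom C f = A" "Cod C f = B"
  using assms by (auto simp: Hom_def)

lemma in_Hom_Dom_Cod: "f \<in> Arr C \<Longrightarrow> f \<in> Hom C (Dom C f) (Cod C f)"
  by (simp add: Hom_def)

lemma (in category) Hom_in_Obj:
  assumes "f \<in> Hom C A B"
  shows "A \<in> Obj C" "B \<in> Obj C"
  using HomD[OF assms] Dom_in_Obj Cod_in_Obj by auto

lemma has_liftD:
  assumes "has_lift C i p" "i \<in> Hom C A B" "p \<in> Hom C E D"
    and "u \<in> Hom C A E" "v \<in> Hom C B D" "p \<cdot>\<^bsub>C\<^esub> u = v \<cdot>\<^bsub>C\<^esub> i"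
  obtains h where "h \<in> Hom C B E" "h \<cdot>\<^bsub>C\<^esub> i = u" "p \<cdot>\<^bsub>C\<^esub> h = v"
  using assms HomD[OF assms(2)] HomD[OF assms(3)] unfolding has_lift_def by blast

lemma is_retractI:
  assumes "f \<in> Hom C A B" "g \<in> Hom C E D"
    and "i \<in> Hom C A E" "r \<in> Hom C E A" "j \<in> Hom C B D" "s \<in> Hom C D B"
    and "r \<cdot>\<^bsub>C\<^esub> i = Ide C A" "s \<cdot>\<^bsub>C\<^esub> j = Ide C B"
    and "g \<cdot>\<^bsub>C\<^esub> i = j \<cdot>\<^bsub>C\<^esub> f" "f \<cdot>\<^bsub>C\<^esub> r = s \<cdot>\<^bsub>C\<^esub> g"
  shows "is_retract C f g"
  unfolding is_retract_def HomD(2,3)[OF assms(1)] HomD(2,3)[OF assms(2)]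
  using HomD(1)[OF assms(1)] HomD(1)[OF assms(2)] assms(3-) by (intro conjI bexI)

text \<open>Retract argument: factor \<open>f\<close> as a trivial cofibration \<open>i\<close>
  followed by a fibration \<open>p\<close>; a lift of \<open>f\<close> against \<open>i\<close>
  makes \<open>f\<close> a retract of \<open>p\<close>. Injective fibrations are given by lifting,
  and this turns a lifting property of their components back into being a fibration.\<close>

lemma (in model_category) fib_eq_rlp: "fib S = rlp C (weq S \<inter> cof S)"
proof
  show "fib S \<subseteq> rlp C (weq S \<inter> cof S)"
    using subcategories(3) lifting_fib by (auto simp: rlp_def wide_subcategory_def)
  show "rlp C (weq S \<inter> cof S) \<subseteq> fib S"
  proof
    fix f assume f: "f \<in> rlp C (weq S \<inter> cof S)"
    define A B where "A = Dom C f" and "B = Cod C f"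
    have fH: "f \<in> Hom C A B"
      using f by (auto simp: rlp_def Hom_def A_def B_def)
    then obtain E i p where i: "i \<in> Hom C A E" and p: "p \<in> Hom C E B" and fpi: "f = p \<cdot> i"
      and ic: "i \<in> weq S \<inter> cof S" and pf: "p \<in> fib S"
      using factorization_fib by blast
    have Obj: "A \<in> Obj C" "B \<in> Obj C"
      using Hom_in_Obj[OF fH] by auto
    have "has_lift C i f"
      using f ic by (auto simp: rlp_def)
    \<comment> \<open>The square has the identity of \<open>A\<close> on top and \<open>p\<close> at
      the bottom, so its diagonal is the retraction sought.\<close>
    moreover have "f \<cdot> Ide C A = p \<cdot> i"
      using Cmp_Ide[OF fH] fpi by simp
    ultimately obtain h where h: "h \<in> Hom C E A" "h \<cdot> i = Ide C A" "f \<cdot> h = p"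
      using has_liftD[OF _ i fH Ide_in_Hom[OF Obj(1)] p] by metis
    have "is_retract C f p"
      by (rule is_retractI[OF fH p i h(1) Ide_in_Hom Ide_in_Hom])
        (use h fpi Obj Ide_in_Hom Ide_Cmp[OF fH] Ide_Cmp[OF p] Ide_Cmp[OF Ide_in_Hom] in auto)
    then show "f \<in> fib S"
      using retracts(3) pf by (auto simp: retract_closed_def)
  qed
qed

text \<open>Dual retract argument: here \<open>f\<close> becomes a retract of its trivial
  cofibration factor. Since lifts detect trivial cofibrations, closure under coproducts can be
  checked summand by summand.\<close>

lemma (in model_category) trivial_cof_eq_llp: "weq S \<inter> cof S = llp C (fib S)"
proof
  show "weq S \<inter> cof S \<subseteq> llp C (fib S)"
    using subcategories(2) lifting_fib by (auto simp: llp_def wide_subcategory_def)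
  show "llp C (fib S) \<subseteq> weq S \<inter> cof S"
  proof
    fix f assume f: "f \<in> llp C (fib S)"
    define A B where "A = Dom C f" and "B = Cod C f"
    have fH: "f \<in> Hom C A B"
      using f by (auto simp: llp_def Hom_def A_def B_def)
    then obtain E i p where i: "i \<in> Hom C A E" and p: "p \<in> Hom C E B" and fpi: "f = p \<cdot> i"
      and ic: "i \<in> weq S \<inter> cof S" and pf: "p \<in> fib S"
      using factorization_fib by blast
    have Obj: "A \<in> Obj C" "B \<in> Obj C"
      using Hom_in_Obj[OF fH] by auto
    have "has_lift C f p"
      using f pf by (auto simp: llp_def)
    moreover have "p \<cdot> i = Ide C B \<cdot> f"
      using Ide_Cmp[OF fH] fpi by simp
    ultimately obtain h where h: "h \<in> Hom C B E" "h \<cdot> f = i" "p \<cdot> h = Ide C B"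
      using has_liftD[OF _ fH p i Ide_in_Hom[OF Obj(2)]] by metis
    have "is_retract C f i"
      by (rule is_retractI[OF fH i Ide_in_Hom Ide_in_Hom h(1) p])
        (use h fpi Obj Ide_in_Hom Cmp_Ide[OF fH] Cmp_Ide[OF i] Ide_Cmp[OF Ide_in_Hom] in auto)
    then show "f \<in> weq S \<inter> cof S"
      using retracts(1,2) ic by (auto simp: retract_closed_def)
  qed
qed


section \<open>Copowers\<close>

text \<open>The coproduct of copies of \<open>K\<close> indexed by \<open>I\<close>. It is phrased
  for an index set of any type instead of a discrete diagram, because the index sets will be hom
  sets; \<iota> is unconstrained off \<open>I\<close>.\<close>

definition is_copower ::
  "('o, 'm, 'z) category_scheme \<Rightarrow> 'o \<Rightarrow> 'i set \<Rightarrow> 'o \<Rightarrow> ('i \<Rightarrow> 'm) \<Rightarrow> bool" where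
  "is_copower C K I Q \<iota> \<longleftrightarrow> Q \<in> Obj C \<and> (\<forall>i \<in> I. \<iota> i \<in> Hom C K Q) \<and>
     (\<forall>A \<in> Obj C. \<forall>\<alpha>. (\<forall>i \<in> I. \<alpha> i \<in> Hom C K A) \<longrightarrow>
        (\<exists>!h. h \<in> Hom C Q A \<and> (\<forall>i \<in> I. h \<cdot>\<^bsub>C\<^esub> \<iota> i = \<alpha> i)))"

definition cotuple ::
  "('o, 'm, 'z) category_scheme \<Rightarrow> 'i set \<Rightarrow> 'o \<Rightarrow> ('i \<Rightarrow> 'm) \<Rightarrow> 'o \<Rightarrow> ('i \<Rightarrow> 'm) \<Rightarrow> 'm" where
  "cotuple C I Q \<iota> A \<alpha> = (THE h. h \<in> Hom C Q A \<and> (\<forall>i \<in> I. h \<cdot>\<^bsub>C\<^esub> \<iota> i = \<alpha> i))"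

lemma cotuple:
  assumes "is_copower C K I Q \<iota>" "A \<in> Obj C" "\<And>i. i \<in> I \<Longrightarrow> \<alpha> i \<in> Hom C K A"
  shows cotuple_in_Hom: "cotuple C I Q \<iota> A \<alpha> \<in> Hom C Q A"
    and cotuple_Cmp: "i \<in> I \<Longrightarrow> cotuple C I Q \<iota> A \<alpha> \<cdot>\<^bsub>C\<^esub> \<iota> i = \<alpha> i"
proof -
  have "\<exists>!h. h \<in> Hom C Q A \<and> (\<forall>i \<in> I. h \<cdot>\<^bsub>C\<^esub> \<iota> i = \<alpha> i)"
    using assms unfolding is_copower_def by blast
  from theI'[OF this]
  show "cotuple C I Q \<iota> A \<alpha> \<in> Hom C Q A"
    and "i \<in> I \<Longrightarrow> cotuple C I Q \<iota> A \<alpha> \<cdot>\<^bsub>C\<^esub> \<iota> i = \<alpha> i"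
    unfolding cotuple_def by auto
qed

lemma (in category) copower_ext:
  assumes Q: "is_copower C K I Q \<iota>" and h: "h \<in> Hom C Q A" and h': "h' \<in> Hom C Q A"
    and eq: "\<And>i. i \<in> I \<Longrightarrow> h \<cdot> \<iota> i = h' \<cdot> \<iota> i"
  shows "h = h'"
proof -
  have "\<forall>i \<in> I. h' \<cdot> \<iota> i \<in> Hom C K A"
    using Q h' Cmp_in_Hom unfolding is_copower_def by blast
  moreover have "\<forall>\<alpha>. (\<forall>i \<in> I. \<alpha> i \<in> Hom C K A) \<longrightarrow>
      (\<exists>!g. g \<in> Hom C Q A \<and> (\<forall>i \<in> I. g \<cdot> \<iota> i = \<alpha> i))"
    using Q Hom_in_Obj(2)[OF h] unfolding is_copower_def by blast
  ultimately have "\<exists>!g. g \<in> Hom C Q A \<and> (\<forall>i \<in> I. g \<cdot> \<iota> i = h' \<cdot> \<iota> i)"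
    by (elim allE[where x = "\<lambda>i. h' \<cdot> \<iota> i"] impE)
  then show ?thesis
    using h h' eq by (elim ex1E) (metis (no_types))
qed

text \<open>\<open>cocomplete\<close> provides colimits only of diagrams indexed in
  \<open>'u\<close>. As \<open>I\<close> is small, it injects into \<open>'u\<close>, and the
  colimit of a constant discrete diagram on its image is the copower.\<close>

lemma (in category) cocomplete_copower:
  fixes U :: "'u itself"
  assumes "cocomplete U C" and I: "small U I" and K: "K \<in> Obj C"
  shows "\<exists>Q \<iota>. is_copower C K I Q \<iota>"
proof -
  have "|I| \<le>o |UNIV :: 'u set|"
    using I by (simp add: small_def ordLess_imp_ordLeq)
  then obtain e :: "_ \<Rightarrow> 'u" where e: "inj_on e I"
    using card_of_ordLeq by metis
  \<comment> \<open>The discrete category on the image of \<open>I\<close>: every arrow is an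
    identity, so composable arrows coincide and \<open>Cmp\<close> may return either one.\<close>
  define J :: "('u, 'u) category" where
    "J = \<lparr>Obj = e ` I, Arr = e ` I, Dom = id, Cod = id, Ide = id, Cmp = (\<lambda>g f. f)\<rparr>"
  have J_sel: "Obj J = e ` I" "Arr J = e ` I"
    by (simp_all add: J_def)
  define D :: "('u, 'u, 'o, 'm) functr" where
    "D = \<lparr>FO = (\<lambda>_. K), FM = (\<lambda>_. Ide C K)\<rparr>"
  note KK = Ide_in_Hom[OF K] Cmp_Ide[OF Ide_in_Hom[OF K]]
  have small: "small U (e ` I)"
    using I e unfolding small_def
    by (metis card_of_image ordLeq_ordLess_trans)
  have "cfunctor J C D"
    by unfold_locales (auto simp: J_def D_def Hom_def K KK[unfolded Hom_def, simplified])
  then obtain Q \<kappa> where Q: "is_colimit C J D Q \<kappa>"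
    using assms(1) small unfolding cocomplete_def by (metis J_sel)
  have cocone: "is_cocone C J D A \<alpha> \<longleftrightarrow> A \<in> Obj C \<and> (\<forall>i \<in> I. \<alpha> (e i) \<in> Hom C K A)" for A \<alpha>
    using Cmp_Ide by (auto simp: is_cocone_def J_def D_def)
  have "is_copower C K I Q (\<kappa> \<circ> e)"
    unfolding is_copower_def
  proof (intro conjI ballI allI impI)
    show "Q \<in> Obj C" "\<And>i. i \<in> I \<Longrightarrow> (\<kappa> \<circ> e) i \<in> Hom C K Q"
      using Q by (auto simp: is_colimit_def cocone)
    fix A \<alpha> assume A: "A \<in> Obj C" and \<alpha>: "\<forall>i \<in> I. \<alpha> i \<in> Hom C K A"
    \<comment> \<open>Reindexing by the inverse of \<open>e\<close> turns a family over
      \<open>I\<close> into a cocone over \<open>J\<close>.\<close>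
    have "is_cocone C J D A (\<alpha> \<circ> the_inv_into I e)"
      using A \<alpha> by (simp add: cocone the_inv_into_f_f[OF e])
    then have "\<exists>!h. h \<in> Hom C Q A \<and> (\<forall>j \<in> Obj J. h \<cdot> \<kappa> j = (\<alpha> \<circ> the_inv_into I e) j)"
      using Q unfolding is_colimit_def by blast
    then show "\<exists>!h. h \<in> Hom C Q A \<and> (\<forall>i \<in> I. h \<cdot> (\<kappa> \<circ> e) i = \<alpha> i)"
      by (simp add: J_sel the_inv_into_f_f[OF e])
  qed
  then show ?thesis by blast
qed

text \<open>By \<open>trivial_cof_eq_llp\<close> only lifts against a fibration \<open>p\<close>
  matter. They exist on each summand because \<open>i\<close> is a trivial cofibration, and they
  glue by the universal property of \<open>QL\<close>. The map \<open>k\<close> is given through its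
  restrictions to the summands, the form in which \<open>free_map\<close> supplies it.\<close>

lemma (in model_category) copower_trivial_cof:
  assumes QK: "is_copower C K I QK \<iota>" and QL: "is_copower C L I QL \<kappa>"
    and i: "i \<in> Hom C K L" "i \<in> weq S \<inter> cof S"
    and k: "k \<in> Hom C QK QL" "\<And>a. a \<in> I \<Longrightarrow> k \<cdot> \<iota> a = \<kappa> a \<cdot> i"
  shows "k \<in> weq S \<inter> cof S"
proof -
  have \<iota>: "\<iota> a \<in> Hom C K QK" and \<kappa>: "\<kappa> a \<in> Hom C L QL" if "a \<in> I" for a
    using that QK QL by (auto simp: is_copower_def)
  have "has_lift C k p" if p: "p \<in> fib S" for p
    unfolding has_lift_def HomD(2,3)[OF k(1)]
  proof (intro ballI impI)
    define E B where "E = Dom C p" and "B = Cod C p"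
    have pH: "p \<in> Hom C E B"
      using p subcategories(3) by (auto simp: Hom_def E_def B_def wide_subcategory_def)
    fix u v assume "u \<in> Hom C QK (Dom C p)" "v \<in> Hom C QL (Cod C p)" and sq: "p \<cdot> u = v \<cdot> k"
    then have u: "u \<in> Hom C QK E" and v: "v \<in> Hom C QL B"
      by (simp_all add: E_def B_def)
    \<comment> \<open>Restricting the square to the summand \<open>a\<close> gives a lifting problem
      for \<open>i\<close> against \<open>p\<close>.\<close>
    have "\<exists>h. h \<in> Hom C L E \<and> h \<cdot> i = u \<cdot> \<iota> a \<and> p \<cdot> h = v \<cdot> \<kappa> a" if a: "a \<in> I" for a
    proof -
      have "p \<cdot> (u \<cdot> \<iota> a) = (v \<cdot> \<kappa> a) \<cdot> i"
        using sq k(2)[OF a] Cmp_assoc[OF \<iota>[OF a] u pH] Cmp_assoc[OF \<iota>[OF a] k(1) v]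
          Cmp_assoc[OF i(1) \<kappa>[OF a] v] by simp
      then show ?thesis
        using has_liftD[OF lifting_fib[OF i(2) p] i(1) pH Cmp_in_Hom[OF \<iota>[OF a] u]
            Cmp_in_Hom[OF \<kappa>[OF a] v]] by metis
    qed
    then obtain \<eta> where \<eta>: "\<And>a. a \<in> I \<Longrightarrow> \<eta> a \<in> Hom C L E \<and> \<eta> a \<cdot> i = u \<cdot> \<iota> a \<and> p \<cdot> \<eta> a = v \<cdot> \<kappa> a"
      by metis
    define h where "h = cotuple C I QL \<kappa> E \<eta>"
    have E: "E \<in> Obj C"
      using Hom_in_Obj[OF pH] by simp
    have h: "h \<in> Hom C QL E"
      unfolding h_def using cotuple_in_Hom[OF QL E] \<eta> by blast
    have h\<kappa>: "h \<cdot> \<kappa> a = \<eta> a" if "a \<in> I" for a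
      unfolding h_def using cotuple_Cmp[OF QL E _ that] \<eta> by blast
    have "h \<cdot> k = u"
    proof (rule copower_ext[OF QK Cmp_in_Hom[OF k(1) h] u])
      fix a assume a: "a \<in> I"
      show "(h \<cdot> k) \<cdot> \<iota> a = u \<cdot> \<iota> a"
        using \<eta>[OF a] h\<kappa>[OF a] k(2)[OF a] Cmp_assoc[OF \<iota>[OF a] k(1) h]
          Cmp_assoc[OF i(1) \<kappa>[OF a] h] by simp
    qed
    moreover have "p \<cdot> h = v"
    proof (rule copower_ext[OF QL Cmp_in_Hom[OF h pH] v])
      fix a assume a: "a \<in> I"
      show "(p \<cdot> h) \<cdot> \<kappa> a = v \<cdot> \<kappa> a"
        using \<eta>[OF a] h\<kappa>[OF a] Cmp_assoc[OF \<kappa>[OF a] h pH] by simp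
    qed
    ultimately show "\<exists>h \<in> Hom C QL (Dom C p). h \<cdot> k = u \<and> p \<cdot> h = v"
      using h by (auto simp: E_def)
  qed
  then show ?thesis
    using HomD(1)[OF k(1)] by (simp add: trivial_cof_eq_llp llp_def)
qed

section \<open>Functor categories\<close>

text \<open>The restriction makes the family extensional. Here \<open>C\<close> is an arbitrary
  record, so domains and codomains are required to be objects for the restricted family to take its
  intended values there.\<close>

lemma in_Hom_functor_catI:
  assumes "F \<in> Obj (functor_cat C D)" "G \<in> Obj (functor_cat C D)"
    and "\<And>t. t \<in> Obj C \<Longrightarrow> \<sigma> t \<in> Hom D (FO F t) (FO G t)"
    and "\<And>k. k \<in> Arr C \<Longrightarrow> Dom C k \<in> Obj C \<and> Cod C k \<in> Obj C
      \<and> FM G k \<cdot>\<^bsub>D\<^esub> \<sigma> (Dom C k) = \<sigma> (Cod C k) \<cdot>\<^bsub>D\<^esub> FM F k"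
  shows "(F, G, \<lambda>t \<in> Obj C. \<sigma> t) \<in> Hom (functor_cat C D) F G"
  unfolding Hom_def[of "functor_cat C D"] using assms by (simp add: functor_cat_def Let_def)

lemma in_Hom_functor_catD:
  assumes "\<sigma> \<in> Hom (functor_cat C D) F G"
  shows "F \<in> Obj (functor_cat C D)" "G \<in> Obj (functor_cat C D)" "cfunctor C D F" "cfunctor C D G"
    and "\<And>t. t \<in> Obj C \<Longrightarrow> component \<sigma> t \<in> Hom D (FO F t) (FO G t)"
    and "\<And>k t t'. k \<in> Hom C t t'
      \<Longrightarrow> FM G k \<cdot>\<^bsub>D\<^esub> component \<sigma> t = component \<sigma> t' \<cdot>\<^bsub>D\<^esub> FM F k"
  using assms by (auto simp: functor_cat_def Let_def component_def Hom_def)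

lemma component_Cmp:
  "t \<in> Obj C \<Longrightarrow> component (\<tau> \<cdot>\<^bsub>functor_cat C D\<^esub> \<sigma>) t = component \<tau> t \<cdot>\<^bsub>D\<^esub> component \<sigma> t"
  by (simp add: functor_cat_def Let_def component_def)

text \<open>An arrow consists of its two ends and an extensional family, so agreement on
  \<open>Obj C\<close> forces HOL equality.\<close>

lemma functor_cat_arr_eqI:
  assumes "\<sigma> \<in> Hom (functor_cat C D) F G" "\<tau> \<in> Hom (functor_cat C D) F G"
    and "\<And>t. t \<in> Obj C \<Longrightarrow> component \<sigma> t = component \<tau> t"
  shows "\<sigma> = \<tau>"
proof -
  have "snd (snd \<sigma>) = snd (snd \<tau>)"
    by (rule extensionalityI[where A = "Obj C"])
      (use assms in \<open>auto simp: functor_cat_def Let_def component_def Hom_def\<close>)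
  then show ?thesis
    using HomD(2,3)[OF assms(1)] HomD(2,3)[OF assms(2)]
    by (auto simp: functor_cat_def Let_def prod_eq_iff)
qed

lemma functor_cat_Cmp_in_Hom:
  assumes \<sigma>: "\<sigma> \<in> Hom (functor_cat C D) F G" and \<tau>: "\<tau> \<in> Hom (functor_cat C D) G H"
  shows "\<tau> \<cdot>\<^bsub>functor_cat C D\<^esub> \<sigma> \<in> Hom (functor_cat C D) F H"
proof -
  note S = in_Hom_functor_catD[OF \<sigma>] and T = in_Hom_functor_catD[OF \<tau>]
  interpret F: cfunctor C D F by (rule S(3))
  interpret G: cfunctor C D G by (rule S(4))
  interpret H: cfunctor C D H by (rule T(4))
  let ?c = "\<lambda>t. component \<tau> t \<cdot>\<^bsub>D\<^esub> component \<sigma> t"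
  have c: "?c t \<in> Hom D (FO F t) (FO H t)" if "t \<in> Obj C" for t
    using F.target.Cmp_in_Hom[OF S(5)[OF that] T(5)[OF that]] .
  have n: "FM H k \<cdot>\<^bsub>D\<^esub> ?c (Dom C k) = ?c (Cod C k) \<cdot>\<^bsub>D\<^esub> FM F k" if "k \<in> Arr C" for k
  proof -
    note k = in_Hom_Dom_Cod[OF that]
    note Obj = F.source.Hom_in_Obj[OF k]
    show ?thesis
      using F.target.Cmp_assoc[OF S(5)[OF Obj(1)] T(5)[OF Obj(1)] H.FM_in_Hom[OF k]]
        F.target.Cmp_assoc[OF S(5)[OF Obj(1)] G.FM_in_Hom[OF k] T(5)[OF Obj(2)]]
        F.target.Cmp_assoc[OF F.FM_in_Hom[OF k] S(5)[OF Obj(2)] T(5)[OF Obj(2)]]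
        S(6)[OF k] T(6)[OF k] by simp
  qed
  have "fst \<sigma> = F" "fst (snd \<tau>) = H"
    using HomD(2)[OF \<sigma>] HomD(3)[OF \<tau>] by (auto simp: functor_cat_def Let_def)
  then have "\<tau> \<cdot>\<^bsub>functor_cat C D\<^esub> \<sigma> = (F, H, \<lambda>t \<in> Obj C. ?c t)"
    by (simp add: functor_cat_def Let_def)
  then show ?thesis
    using in_Hom_functor_catI[OF S(1) T(2) c] n F.source.Dom_in_Obj F.source.Cod_in_Obj by simp
qed


section \<open>The left adjoint of evaluation\<close>

text \<open>The coprojection \<open>\<iota> K f\<close> into \<open>Q K t\<close> does not mention \<open>t\<close>, which is the codomain of \<open>f\<close>.\<close>

locale chosen_copowers =
  source: category C + target: category D
  for C :: "('o, 'm, 'z) category_scheme"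
    and D :: "('p, 'n, 'y) category_scheme" +
  fixes s :: 'o and Q :: "'p \<Rightarrow> 'o \<Rightarrow> 'p" and \<iota> :: "'p \<Rightarrow> 'm \<Rightarrow> 'n"
  assumes s: "s \<in> Obj C"
    and copower: "K \<in> Obj D \<Longrightarrow> t \<in> Obj C \<Longrightarrow> is_copower D K (Hom C s t) (Q K t) (\<iota> K)"
begin

definition ctp :: "'p \<Rightarrow> 'o \<Rightarrow> 'p \<Rightarrow> ('m \<Rightarrow> 'n) \<Rightarrow> 'n" where
  "ctp K t = cotuple D (Hom C s t) (Q K t) (\<iota> K)"

lemma Q_in_Obj: "K \<in> Obj D \<Longrightarrow> t \<in> Obj C \<Longrightarrow> Q K t \<in> Obj D"
  using copower by (auto simp: is_copower_def)

lemma \<iota>_in_Hom: "K \<in> Obj D \<Longrightarrow> f \<in> Hom C s t \<Longrightarrow> \<iota> K f \<in> Hom D K (Q K t)"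
  using copower[of K t] source.Hom_in_Obj(2)[of f s t] by (simp add: is_copower_def)

lemma ctp_in_Hom:
  assumes "K \<in> Obj D" "t \<in> Obj C" "A \<in> Obj D" "\<And>f. f \<in> Hom C s t \<Longrightarrow> \<alpha> f \<in> Hom D K A"
  shows "ctp K t A \<alpha> \<in> Hom D (Q K t) A"
  unfolding ctp_def using assms copower by (intro cotuple_in_Hom)

lemma ctp_Cmp:
  assumes "K \<in> Obj D" "A \<in> Obj D" "\<And>f. f \<in> Hom C s t \<Longrightarrow> \<alpha> f \<in> Hom D K A" "f \<in> Hom C s t"
  shows "ctp K t A \<alpha> \<cdot>\<^bsub>D\<^esub> \<iota> K f = \<alpha> f"
  unfolding ctp_def
  by (rule cotuple_Cmp[OF copower[OF assms(1) source.Hom_in_Obj(2)[OF assms(4)]] assms(2,3,4)])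

lemma Q_ext:
  assumes "K \<in> Obj D" "t \<in> Obj C" "h \<in> Hom D (Q K t) A" "h' \<in> Hom D (Q K t) A"
    and "\<And>f. f \<in> Hom C s t \<Longrightarrow> h \<cdot>\<^bsub>D\<^esub> \<iota> K f = h' \<cdot>\<^bsub>D\<^esub> \<iota> K f"
  shows "h = h'"
  by (rule target.copower_ext[OF copower[OF assms(1,2)] assms(3,4)]) (rule assms(5))

definition Qmap :: "'p \<Rightarrow> 'm \<Rightarrow> 'n" where
  "Qmap K k = ctp K (Dom C k) (Q K (Cod C k)) (\<lambda>f. \<iota> K (k \<cdot>\<^bsub>C\<^esub> f))"

lemma Qmap:
  assumes "K \<in> Obj D" "k \<in> Hom C t t'"
  shows Qmap_in_Hom: "Qmap K k \<in> Hom D (Q K t) (Q K t')"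
    and Qmap_Cmp: "f \<in> Hom C s t \<Longrightarrow> Qmap K k \<cdot>\<^bsub>D\<^esub> \<iota> K f = \<iota> K (k \<cdot>\<^bsub>C\<^esub> f)"
proof -
  have \<alpha>: "\<iota> K (k \<cdot>\<^bsub>C\<^esub> f) \<in> Hom D K (Q K t')" if "f \<in> Hom C s t" for f
    using \<iota>_in_Hom[OF assms(1) source.Cmp_in_Hom[OF that assms(2)]] .
  have Obj: "t \<in> Obj C" "Q K t' \<in> Obj D"
    using source.Hom_in_Obj[OF assms(2)] Q_in_Obj assms(1) by auto
  show "Qmap K k \<in> Hom D (Q K t) (Q K t')"
    unfolding Qmap_def HomD(2,3)[OF assms(2)] using \<alpha> Obj assms(1) by (intro ctp_in_Hom)
  show "Qmap K k \<cdot>\<^bsub>D\<^esub> \<iota> K f = \<iota> K (k \<cdot>\<^bsub>C\<^esub> f)" if "f \<in> Hom C s t"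
    unfolding Qmap_def HomD(2,3)[OF assms(2)] using \<alpha> Obj(2) assms(1) that by (intro ctp_Cmp)
qed

text \<open>The representable functor of \<open>s\<close> copowered with \<open>K\<close>: an arrow
  \<open>k\<close> carries the copy of \<open>K\<close> at \<open>f\<close> to the copy at the
  composite of \<open>f\<close> and \<open>k\<close>. The restrictions make it extensional, as
  objects of \<open>functor_cat\<close> have to be.\<close>

definition free_functor :: "'p \<Rightarrow> ('o, 'm, 'p, 'n) functr" where
  "free_functor K = \<lparr>FO = \<lambda>t \<in> Obj C. Q K t, FM = \<lambda>k \<in> Arr C. Qmap K k\<rparr>"

lemma free_functor_sel:
  "t \<in> Obj C \<Longrightarrow> FO (free_functor K) t = Q K t"
  "k \<in> Hom C t t' \<Longrightarrow> FM (free_functor K) k = Qmap K k"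
  by (simp_all add: free_functor_def Hom_def)

text \<open>Tested on coprojections, the functor laws become a unit law and associativity in
  \<open>C\<close>.\<close>

lemma free_functor_in_Obj:
  assumes K: "K \<in> Obj D"
  shows "free_functor K \<in> Obj (functor_cat C D)"
proof -
  have "cfunctor C D (free_functor K)"
  proof unfold_locales
    fix A assume A: "A \<in> Obj C"
    then show "FO (free_functor K) A \<in> Obj D"
      by (simp add: free_functor_sel Q_in_Obj K)
    note idA = source.Ide_in_Hom[OF A]
    have "Qmap K (Ide C A) = Ide D (Q K A)"
    proof (rule Q_ext[OF K A Qmap_in_Hom[OF K idA] target.Ide_in_Hom[OF Q_in_Obj[OF K A]]])
      fix f assume f: "f \<in> Hom C s A"
      show "Qmap K (Ide C A) \<cdot>\<^bsub>D\<^esub> \<iota> K f = Ide D (Q K A) \<cdot>\<^bsub>D\<^esub> \<iota> K f"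
        using Qmap_Cmp[OF K idA f] source.Ide_Cmp[OF f] target.Ide_Cmp[OF \<iota>_in_Hom[OF K f]]
        by simp
    qed
    then show "FM (free_functor K) (Ide C A) = Ide D (FO (free_functor K) A)"
      by (simp add: free_functor_sel(1)[OF A] free_functor_sel(2)[OF source.Ide_in_Hom[OF A]])
  next
    fix f A B assume f: "f \<in> Hom C A B"
    note Obj = source.Hom_in_Obj[OF f]
    show "FM (free_functor K) f \<in> Hom D (FO (free_functor K) A) (FO (free_functor K) B)"
      by (simp add: free_functor_sel(1)[OF Obj(1)] free_functor_sel(1)[OF Obj(2)]
          free_functor_sel(2)[OF f] Qmap_in_Hom[OF K f])
    fix g E assume g: "g \<in> Hom C B E"
    note gf = source.Cmp_in_Hom[OF f g]
    note fD = Qmap_in_Hom[OF K f] and gD = Qmap_in_Hom[OF K g]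
    have "Qmap K (g \<cdot>\<^bsub>C\<^esub> f) = Qmap K g \<cdot>\<^bsub>D\<^esub> Qmap K f"
    proof (rule Q_ext[OF K Obj(1) Qmap_in_Hom[OF K gf] target.Cmp_in_Hom[OF fD gD]])
      fix a assume a: "a \<in> Hom C s A"
      show "Qmap K (g \<cdot>\<^bsub>C\<^esub> f) \<cdot>\<^bsub>D\<^esub> \<iota> K a = (Qmap K g \<cdot>\<^bsub>D\<^esub> Qmap K f) \<cdot>\<^bsub>D\<^esub> \<iota> K a"
        using Qmap_Cmp[OF K gf a] Qmap_Cmp[OF K f a] Qmap_Cmp[OF K g source.Cmp_in_Hom[OF a f]]
          target.Cmp_assoc[OF \<iota>_in_Hom[OF K a] fD gD] source.Cmp_assoc[OF a f g] by simp
    qed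
    then show "FM (free_functor K) (g \<cdot>\<^bsub>C\<^esub> f) = FM (free_functor K) g \<cdot>\<^bsub>D\<^esub> FM (free_functor K) f"
      by (simp add: free_functor_sel(2)[OF f] free_functor_sel(2)[OF g] free_functor_sel(2)[OF gf])
  qed
  then show ?thesis
    by (simp add: functor_cat_def Let_def free_functor_def)
qed

text \<open>The natural transformation corresponding to \<open>a : K -> F s\<close> under the
  adjunction with evaluation at \<open>s\<close>. As in the Yoneda lemma, its value on the summand
  of \<open>f\<close> is forced to be \<open>a\<close> followed by \<open>F f\<close>.\<close>

definition transpose :: "'p \<Rightarrow> ('o, 'm, 'p, 'n) functr \<Rightarrow> 'n \<Rightarrow> ('o, 'm, 'p, 'n) nattr" where
  "transpose K F a =
    (free_functor K, F, \<lambda>t \<in> Obj C. ctp K t (FO F t) (\<lambda>f. FM F f \<cdot>\<^bsub>D\<^esub> a))"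

text \<open>Taking \<open>f\<close> to be the identity of \<open>s\<close> in
  \<open>transpose_Cmp\<close> recovers \<open>a\<close>; the final lift is checked in this
  way.\<close>

lemma transpose:
  assumes K: "K \<in> Obj D" and F: "F \<in> Obj (functor_cat C D)" and a: "a \<in> Hom D K (FO F s)"
  shows transpose_in_Hom: "transpose K F a \<in> Hom (functor_cat C D) (free_functor K) F"
    and transpose_component_in_Hom:
      "t \<in> Obj C \<Longrightarrow> component (transpose K F a) t \<in> Hom D (Q K t) (FO F t)"
    and transpose_Cmp: "f \<in> Hom C s t
      \<Longrightarrow> component (transpose K F a) t \<cdot>\<^bsub>D\<^esub> \<iota> K f = FM F f \<cdot>\<^bsub>D\<^esub> a"
proof -
  interpret F: cfunctor C D F
    using F by (simp add: functor_cat_def Let_def)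
  let ?\<sigma> = "\<lambda>t. ctp K t (FO F t) (\<lambda>f. FM F f \<cdot>\<^bsub>D\<^esub> a)"
  have \<alpha>: "FM F f \<cdot>\<^bsub>D\<^esub> a \<in> Hom D K (FO F t)" if "f \<in> Hom C s t" for f t
    using target.Cmp_in_Hom[OF a F.FM_in_Hom[OF that]] .
  have H: "?\<sigma> t \<in> Hom D (Q K t) (FO F t)" if "t \<in> Obj C" for t
    using ctp_in_Hom[OF K that F.FO_in_Obj[OF that] \<alpha>] .
  have C: "?\<sigma> t \<cdot>\<^bsub>D\<^esub> \<iota> K f = FM F f \<cdot>\<^bsub>D\<^esub> a" if "f \<in> Hom C s t" for f t
    using ctp_Cmp[OF K F.FO_in_Obj[OF source.Hom_in_Obj(2)[OF that]] \<alpha> that] .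
  show "component (transpose K F a) t \<in> Hom D (Q K t) (FO F t)" if "t \<in> Obj C"
    using H[OF that] that by (simp add: transpose_def component_def)
  show "component (transpose K F a) t \<cdot>\<^bsub>D\<^esub> \<iota> K f = FM F f \<cdot>\<^bsub>D\<^esub> a" if "f \<in> Hom C s t"
    using C[OF that] source.Hom_in_Obj(2)[OF that] by (simp add: transpose_def component_def)
  \<comment> \<open>Naturality holds because on the summand of \<open>f\<close> both sides are
    \<open>a\<close> followed by \<open>F f\<close> and then \<open>F k\<close>.\<close>
  have N: "FM F k \<cdot>\<^bsub>D\<^esub> ?\<sigma> t = ?\<sigma> t' \<cdot>\<^bsub>D\<^esub> Qmap K k" if k: "k \<in> Hom C t t'" for k t t'
  proof -
    note Obj = source.Hom_in_Obj[OF k]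
    note kD = Qmap_in_Hom[OF K k] and Fk = F.FM_in_Hom[OF k]
    show ?thesis
    proof (rule Q_ext[OF K Obj(1) target.Cmp_in_Hom[OF H[OF Obj(1)] Fk]
          target.Cmp_in_Hom[OF kD H[OF Obj(2)]]])
      fix f assume f: "f \<in> Hom C s t"
      show "(FM F k \<cdot>\<^bsub>D\<^esub> ?\<sigma> t) \<cdot>\<^bsub>D\<^esub> \<iota> K f = (?\<sigma> t' \<cdot>\<^bsub>D\<^esub> Qmap K k) \<cdot>\<^bsub>D\<^esub> \<iota> K f"
        using target.Cmp_assoc[OF \<iota>_in_Hom[OF K f] H[OF Obj(1)] Fk] C[OF f]
          target.Cmp_assoc[OF \<iota>_in_Hom[OF K f] kD H[OF Obj(2)]] Qmap_Cmp[OF K k f]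
          C[OF source.Cmp_in_Hom[OF f k]] F.FM_Cmp[OF f k]
          target.Cmp_assoc[OF a F.FM_in_Hom[OF f] Fk] by simp
    qed
  qed
  have "FM F k \<cdot>\<^bsub>D\<^esub> ?\<sigma> (Dom C k) = ?\<sigma> (Cod C k) \<cdot>\<^bsub>D\<^esub> FM (free_functor K) k" if "k \<in> Arr C" for k
    using N[OF in_Hom_Dom_Cod[OF that]] free_functor_sel(2)[OF in_Hom_Dom_Cod[OF that]] by simp
  then show "transpose K F a \<in> Hom (functor_cat C D) (free_functor K) F"
    unfolding transpose_def using free_functor_in_Obj[OF K] F H
    by (intro in_Hom_functor_catI) (auto simp: free_functor_sel source.Dom_in_Obj source.Cod_in_Obj)
qed

text \<open>The action of the free functor on arrows, as the transpose of \<open>i\<close> followed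
  by the unit of the adjunction at \<open>L\<close>. That unit is the coprojection of the identity
  of \<open>s\<close>.\<close>

definition free_map :: "'p \<Rightarrow> 'p \<Rightarrow> 'n \<Rightarrow> ('o, 'm, 'p, 'n) nattr" where
  "free_map K L i = transpose K (free_functor L) (\<iota> L (Ide C s) \<cdot>\<^bsub>D\<^esub> i)"

lemma free_map:
  assumes i: "i \<in> Hom D K L"
  shows free_map_in_Hom: "free_map K L i \<in> Hom (functor_cat C D) (free_functor K) (free_functor L)"
    and free_map_component_in_Hom:
      "t \<in> Obj C \<Longrightarrow> component (free_map K L i) t \<in> Hom D (Q K t) (Q L t)"
    and free_map_Cmp: "f \<in> Hom C s t
      \<Longrightarrow> component (free_map K L i) t \<cdot>\<^bsub>D\<^esub> \<iota> K f = \<iota> L f \<cdot>\<^bsub>D\<^esub> i"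
proof -
  note KL = target.Hom_in_Obj[OF i]
  note \<iota>s = \<iota>_in_Hom[OF KL(2) source.Ide_in_Hom[OF s]]
  have a: "\<iota> L (Ide C s) \<cdot>\<^bsub>D\<^esub> i \<in> Hom D K (FO (free_functor L) s)"
    using target.Cmp_in_Hom[OF i \<iota>s] by (simp add: free_functor_sel s)
  note T = transpose[OF KL(1) free_functor_in_Obj[OF KL(2)] a, folded free_map_def]
  show "free_map K L i \<in> Hom (functor_cat C D) (free_functor K) (free_functor L)"
    using T(1) .
  show "component (free_map K L i) t \<in> Hom D (Q K t) (Q L t)" if "t \<in> Obj C"
    using T(2)[OF that] that by (simp add: free_functor_sel)
  \<comment> \<open>The action of \<open>f\<close> moves the summand of the identity to the summand
    of \<open>f\<close>. The resulting equation is the condition on \<open>k\<close> in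
    \<open>copower_trivial_cof\<close>.\<close>
  show "component (free_map K L i) t \<cdot>\<^bsub>D\<^esub> \<iota> K f = \<iota> L f \<cdot>\<^bsub>D\<^esub> i" if f: "f \<in> Hom C s t"
    using T(3)[OF f] target.Cmp_assoc[OF i \<iota>s Qmap_in_Hom[OF KL(2) f]]
      Qmap_Cmp[OF KL(2) f source.Ide_in_Hom[OF s]]
    by (simp add: free_functor_sel(2)[OF f] source.Cmp_Ide[OF f])
qed

end

section \<open>Injective fibrations are level-wise fibrations\<close>

text \<open>By \<open>fib_eq_rlp\<close> it is enough to lift \<open>component p s\<close> against a
  trivial cofibration \<open>i\<close>. This problem transposes to one for
  \<open>free_map K L i\<close> against \<open>p\<close>, solvable because the free map is
  level-wise a trivial cofibration. Smallness of the hom sets supplies the copowers.\<close>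

lemma injective_fib_subset_levelwise:
  fixes U :: "'u itself"
  assumes "model_category U D S"
    and small: "\<And>s t. s \<in> Obj C \<Longrightarrow> t \<in> Obj C \<Longrightarrow> small U (Hom C s t)"
  shows "rlp (functor_cat C D) (levelwise C D (weq S) \<inter> levelwise C D (cof S)) \<subseteq> levelwise C D (fib S)"
proof
  interpret model_category U D S by fact
  let ?N = "functor_cat C D"
  fix p assume p: "p \<in> rlp ?N (levelwise C D (weq S) \<inter> levelwise C D (cof S))"
  obtain F G where pH: "p \<in> Hom ?N F G"
    using p in_Hom_Dom_Cod[of p ?N] by (auto simp: rlp_def)
  note P = in_Hom_functor_catD[OF pH]
  interpret F: cfunctor C D F by (rule P(3))
  interpret G: cfunctor C D G by (rule P(4))
  have "component p s \<in> fib S" if s: "s \<in> Obj C" for s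
  proof -
    have "\<forall>K t. \<exists>Q \<iota>. K \<in> Obj D \<and> t \<in> Obj C \<longrightarrow> is_copower D K (Hom C s t) Q \<iota>"
      using cocomplete_copower[OF cocomplete small[OF s]] by blast
    then have "\<exists>Q \<iota>. \<forall>K t. K \<in> Obj D \<and> t \<in> Obj C \<longrightarrow> is_copower D K (Hom C s t) (Q K t) (\<iota> K t)"
      unfolding choice_iff .
    then obtain Q \<iota>' where
      Q: "\<And>K t. K \<in> Obj D \<Longrightarrow> t \<in> Obj C \<Longrightarrow> is_copower D K (Hom C s t) (Q K t) (\<iota>' K t)"
      by blast
    \<comment> \<open>The coprojections were chosen separately for each \<open>t\<close>; as
      \<open>t\<close> is the codomain of \<open>f\<close>, this dependence can be absorbed.\<close>
    define \<iota> where "\<iota> K f = \<iota>' K (Cod C f) f" for K f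
    interpret chosen_copowers C D s Q \<iota>
    proof
      show "is_copower D K (Hom C s t) (Q K t) (\<iota> K)" if "K \<in> Obj D" "t \<in> Obj C" for K t
        using Q[OF that] by (simp add: is_copower_def \<iota>_def HomD(3)[where C = C])
    qed (rule s)
    note ids = F.source.Ide_in_Hom[OF s]
    note ps = P(5)[OF s]
    have "has_lift D i (component p s)" if i: "i \<in> weq S \<inter> cof S" for i
      unfolding has_lift_def HomD(2,3)[OF ps]
    proof (intro ballI impI)
      define K L where "K = Dom D i" and "L = Cod D i"
      have iH: "i \<in> Hom D K L"
        using i subcategories(2) by (auto simp: Hom_def K_def L_def wide_subcategory_def)
      note KL = Hom_in_Obj[OF iH]
      fix u v assume "u \<in> Hom D (Dom D i) (FO F s)" "v \<in> Hom D (Cod D i) (FO G s)"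
        and sq: "component p s \<cdot>\<^bsub>D\<^esub> u = v \<cdot>\<^bsub>D\<^esub> i"
      then have u: "u \<in> Hom D K (FO F s)" and v: "v \<in> Hom D L (FO G s)"
        by (simp_all add: K_def L_def)
      note iN = free_map_in_Hom[OF iH]
      note uN = transpose_in_Hom[OF KL(1) P(1) u] and vN = transpose_in_Hom[OF KL(2) P(2) v]
      have "component (free_map K L i) t \<in> weq S \<inter> cof S" if t: "t \<in> Obj C" for t
        using copower_trivial_cof[OF copower[OF KL(1) t] copower[OF KL(2) t] iH i
            free_map_component_in_Hom[OF iH t] free_map_Cmp[OF iH]] .
      then have "has_lift ?N (free_map K L i) p"
        using p HomD(1)[OF iN] by (auto simp: rlp_def levelwise_def)
      \<comment> \<open>On the summand of \<open>f\<close> both composites are \<open>i\<close>,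
        then \<open>v\<close>, then \<open>G f\<close>, by naturality of \<open>p\<close> and the
        given square at \<open>s\<close>.\<close>
      moreover have "p \<cdot>\<^bsub>?N\<^esub> transpose K F u = transpose L G v \<cdot>\<^bsub>?N\<^esub> free_map K L i"
      proof (rule functor_cat_arr_eqI[OF functor_cat_Cmp_in_Hom[OF uN pH]
            functor_cat_Cmp_in_Hom[OF iN vN]])
        fix t assume t: "t \<in> Obj C"
        note ut = transpose_component_in_Hom[OF KL(1) P(1) u t]
          and vt = transpose_component_in_Hom[OF KL(2) P(2) v t]
          and it = free_map_component_in_Hom[OF iH t]
        have "component p t \<cdot>\<^bsub>D\<^esub> component (transpose K F u) t =
            component (transpose L G v) t \<cdot>\<^bsub>D\<^esub> component (free_map K L i) t"
        proof (rule Q_ext[OF KL(1) t Cmp_in_Hom[OF ut P(5)[OF t]] Cmp_in_Hom[OF it vt]])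
          fix f assume f: "f \<in> Hom C s t"
          note \<iota>f = \<iota>_in_Hom[OF KL(1) f]
          have "(component p t \<cdot>\<^bsub>D\<^esub> component (transpose K F u) t) \<cdot>\<^bsub>D\<^esub> \<iota> K f =
              component p t \<cdot>\<^bsub>D\<^esub> (FM F f \<cdot>\<^bsub>D\<^esub> u)"
            using Cmp_assoc[OF \<iota>f ut P(5)[OF t]] transpose_Cmp[OF KL(1) P(1) u f] by simp
          also have "\<dots> = (FM G f \<cdot>\<^bsub>D\<^esub> v) \<cdot>\<^bsub>D\<^esub> i"
            using Cmp_assoc[OF u F.FM_in_Hom[OF f] P(5)[OF t]] P(6)[OF f] sq
              Cmp_assoc[OF u ps G.FM_in_Hom[OF f]] Cmp_assoc[OF iH v G.FM_in_Hom[OF f]] by simp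
          also have "\<dots> = (component (transpose L G v) t \<cdot>\<^bsub>D\<^esub> component (free_map K L i) t) \<cdot>\<^bsub>D\<^esub> \<iota> K f"
            using Cmp_assoc[OF \<iota>f it vt] free_map_Cmp[OF iH f] transpose_Cmp[OF KL(2) P(2) v f]
              Cmp_assoc[OF iH \<iota>_in_Hom[OF KL(2) f] vt] by simp
          finally show "(component p t \<cdot>\<^bsub>D\<^esub> component (transpose K F u) t) \<cdot>\<^bsub>D\<^esub> \<iota> K f =
              (component (transpose L G v) t \<cdot>\<^bsub>D\<^esub> component (free_map K L i) t) \<cdot>\<^bsub>D\<^esub> \<iota> K f" .
        qed
        then show "component (p \<cdot>\<^bsub>?N\<^esub> transpose K F u) t =
            component (transpose L G v \<cdot>\<^bsub>?N\<^esub> free_map K L i) t"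
          by (simp add: component_Cmp[OF t])
      qed
      ultimately obtain h where h: "h \<in> Hom ?N (free_functor L) F"
        and hi: "h \<cdot>\<^bsub>?N\<^esub> free_map K L i = transpose K F u" and hp: "p \<cdot>\<^bsub>?N\<^esub> h = transpose L G v"
        using has_liftD[OF _ iN pH uN vN] by metis
      \<comment> \<open>Back across the adjunction: the lift at \<open>s\<close> is
        \<open>component h s\<close> precomposed with the unit, the coprojection of the identity of
        \<open>s\<close>.\<close>
      have hs: "component h s \<in> Hom D (Q L s) (FO F s)"
        using in_Hom_functor_catD(5)[OF h s] by (simp add: free_functor_sel s)
      note \<iota>K = \<iota>_in_Hom[OF KL(1) ids] and \<iota>L = \<iota>_in_Hom[OF KL(2) ids]
      have "(component h s \<cdot>\<^bsub>D\<^esub> \<iota> L (Ide C s)) \<cdot>\<^bsub>D\<^esub> i = u"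
        using Cmp_assoc[OF iH \<iota>L hs] free_map_Cmp[OF iH ids]
          Cmp_assoc[OF \<iota>K free_map_component_in_Hom[OF iH s] hs]
          component_Cmp[OF s, of D h "free_map K L i"] hi
          transpose_Cmp[OF KL(1) P(1) u ids] F.FM_Ide[OF s] Ide_Cmp[OF u] by simp
      moreover have "component p s \<cdot>\<^bsub>D\<^esub> (component h s \<cdot>\<^bsub>D\<^esub> \<iota> L (Ide C s)) = v"
        using Cmp_assoc[OF \<iota>L hs ps] component_Cmp[OF s, of D p h] hp
          transpose_Cmp[OF KL(2) P(2) v ids] G.FM_Ide[OF s] Ide_Cmp[OF v] by simp
      moreover have "component h s \<cdot>\<^bsub>D\<^esub> \<iota> L (Ide C s) \<in> Hom D (Cod D i) (FO F s)"
        using Cmp_in_Hom[OF \<iota>L hs] by (simp add: L_def)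
      ultimately show "\<exists>h \<in> Hom D (Cod D i) (FO F s). h \<cdot>\<^bsub>D\<^esub> i = u \<and> component p s \<cdot>\<^bsub>D\<^esub> h = v"
        by blast
    qed
    then show ?thesis
      using HomD(1)[OF ps] by (simp add: fib_eq_rlp rlp_def)
  qed
  then show "p \<in> levelwise C D (fib S)"
    using HomD(1)[OF pH] by (simp add: levelwise_def)
qed

section \<open>From diagrams on sequences to lax functors\<close>

lemma finite_Hom_seq_cat: "finite (Hom (seq_cat X A B) s t)"
proof -
  have "Hom (seq_cat X A B) s t \<subseteq> {s} \<times> {t} \<times> ({..<degree s} \<rightarrow>\<^sub>E {..<degree t})"
    by (auto simp: Hom_def seq_cat_def)
  then show ?thesis
    by (rule finite_subset) (intro finite_cartesian_product finite_PiE; simp)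
qed

text \<open>The inclusion holds factor by factor: the hom sets of the indexing categories are
  finite, hence small because \<open>'u\<close> is infinite.\<close>

lemma K_inj_fib_subset_K_proj_fib:
  fixes U :: "'u itself"
  assumes "infinite (UNIV :: 'u set)" "model_category U M S"
  shows "fib (K_inj M S X) \<subseteq> fib (K_proj M S X)"
proof -
  have "small U (Hom (op_cat (seq_cat X A B)) s t)" for A B s t
  proof -
    have "Hom (op_cat (seq_cat X A B)) s t = Hom (seq_cat X A B) t s"
      by (auto simp: Hom_def op_cat_def)
    then show ?thesis
      unfolding small_def
      by (intro finite_ordLess_infinite card_of_Well_order)
        (simp_all add: Field_card_of finite_Hom_seq_cat assms(1))
  qed
  then have "fib (injective_structure (op_cat (seq_cat X A B)) M S)
      \<subseteq> fib (projective_structure (op_cat (seq_cat X A B)) M S)" for A B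
    using injective_fib_subset_levelwise[OF assms(2), of "op_cat (seq_cat X A B)"]
    by (simp add: injective_structure_def projective_structure_def)
  then show ?thesis
    unfolding K_inj_def K_proj_def product_structure_def model_structure.simps
    by (intro PiE_mono) (simp only: split_beta)
qed

lemma weq_K_inj: "weq (K_inj M S X) = weq (K_proj M S X)"
  unfolding K_inj_def K_proj_def product_structure_def
  by (auto simp only: model_structure.simps injective_structure_def projective_structure_def split_beta)

lemma (in category) adjunction_id_functor: "adjunction C C id_functor id_functor (\<lambda>A B f. f)"
  by unfold_locales (simp_all add: id_functor_def bij_betw_def)

theorem corollary7p8:
  fixes U :: "'u itself"
    and M :: "('o, 'm) sm_category"
    and S :: "'m model_structure"
    and X :: "'x set"
  assumes "infinite (UNIV :: 'u set)"
    and "symmetric_monoidal_model_category U M S"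
    and "cofibrantly_generated U M S"
    and "\<forall>A \<in> Obj M. cofibrant M S A"
    and "X \<noteq> {}"
    and proj: "model_category U (lax_cat M X) (lax_proj M S X)"
    and inj: "model_category U (lax_cat M X) (lax_inj M S X)"
  shows "quillen_equivalence U
    (lax_cat M X) (lax_proj M S X) (lax_cat M X) (lax_inj M S X)
    id_functor id_functor (\<lambda>A B f. f)"
proof -
  have M: "model_category U M S"
    using assms(2) by (simp add: symmetric_monoidal_model_category_def)
  have weq: "weq (lax_inj M S X) = weq (lax_proj M S X)"
    by (simp add: lax_inj_def lax_proj_def transferred_structure_def Let_def weq_K_inj)
  \<comment> \<open>Fibrations are created by forgetting the laxity maps, so the comparison in the
    product category carries over to lax functors.\<close>
  have "weq (lax_inj M S X) \<inter> fib (lax_inj M S X) \<subseteq> weq (lax_proj M S X) \<inter> fib (lax_proj M S X)"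
    unfolding weq using K_inj_fib_subset_K_proj_fib[OF assms(1) M, of X]
    by (auto simp: lax_inj_def lax_proj_def transferred_structure_def Let_def)
  \<comment> \<open>Fewer trivial fibrations leave fewer lifting conditions, so the inclusion of
    cofibrations goes the other way.\<close>
  then have "llp (lax_cat M X) (weq (lax_proj M S X) \<inter> fib (lax_proj M S X))
      \<subseteq> llp (lax_cat M X) (weq (lax_inj M S X) \<inter> fib (lax_inj M S X))"
    unfolding llp_def by blast
  then have cof: "cof (lax_proj M S X) \<subseteq> cof (lax_inj M S X)"
    by (simp add: lax_inj_def lax_proj_def transferred_structure_def Let_def)
  interpret proj: model_category U "lax_cat M X" "lax_proj M S X" by (rule proj)
  \<comment> \<open>The identity functor preserves cofibrations by \<open>cof\<close>, and trivial
    ones by \<open>weq\<close> as well. A map and its adjunct are the same arrow, so with equal weak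
    equivalences the condition for a Quillen equivalence is immediate.\<close>
  show ?thesis
    using proj inj weq cof proj.adjunction_id_functor
    unfolding quillen_equivalence_def quillen_equivalence_axioms_def quillen_adjunction_def
      quillen_adjunction_axioms_def
    by (simp add: id_functor_def) blast
qed

end
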